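(* For every integer $n \geq 4$, $NFC(3,n) \leq n/2$.
   Context: A family $\mathcal{F}$ of finite sets is union-closed (UC) if $A \cup B \in \mathcal{F}$ for all $A,B \in \mathcal{F}$. Write $U(\mathcal{F})$ for the union of all members of $\mathcal{F}$, and $[n]=\{1,\dots,n\}$. For a family $\mathcal{S}$ of sets, $\langle \mathcal{S}\rangle$ (the family generated by $\mathcal{S}$) is the smallest UC family containing $\mathcal{S}$. A UC family $\mathcal{A}$ is Frankl-Complete (FC) if for every UC family $\mathcal{F} \supseteq \mathcal{A}$ there exists $i \in U(\mathcal{A})$ contained in at least $|\mathcal{F}|/2$ members of $\mathcal{F}$; otherwise $\mathcal{A}$ is Non-FC. A $k$-set is a set of cardinality $k$. For $n \geq 4$, $NFC(3,n)$ denotes the largest integer $k$ such that there exists a family $\mathcal{A} \subset 2^{[n]}$ of $k$ distinct 3-sets with $U(\mathcal{A})=[n]$ and $\langle \mathcal{A}\rangle$ Non-FC, and such that for every family $\mathcal{B}\subset 2^{[n]}$ of $k+1$ distinct 3-sets with $U(\mathcal{B})=[n]$, $\langle\mathcal{B}\rangle$ is FC. *)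

theory Defs
  imports Main
begin

definition union_closed :: "nat set set \<Rightarrow> bool" where
  "union_closed F \<longleftrightarrow> (\<forall>A\<in>F. \<forall>B\<in>F. A \<union> B \<in> F)"

definition generated :: "nat set set \<Rightarrow> nat set set" where
  "generated S = \<Inter>{F. S \<subseteq> F \<and> union_closed F}"

definition frankl_complete :: "nat set set \<Rightarrow> bool" where
  "frankl_complete A \<longleftrightarrow> union_closed A \<and>
     (\<forall>F. finite F \<and> (\<forall>X\<in>F. finite X) \<and> union_closed F \<and> A \<subseteq> F \<longrightarrow>
        (\<exists>i\<in>\<Union>A. 2 * card {X\<in>F. i \<in> X} \<ge> card F))"

definition non_frankl_complete :: "nat set set \<Rightarrow> bool" where
  "non_frankl_complete A \<longleftrightarrow> union_closed A \<and> \<not> frankl_complete A"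

definition three_cover :: "nat \<Rightarrow> nat \<Rightarrow> nat set set \<Rightarrow> bool" where
  "three_cover n k A \<longleftrightarrow> A \<subseteq> Pow {1..n} \<and> card A = k \<and> (\<forall>X\<in>A. card X = 3)
      \<and> \<Union>A = {1..n}"

definition NFC3_prop :: "nat \<Rightarrow> nat \<Rightarrow> bool" where
  "NFC3_prop n k \<longleftrightarrow>
     (\<exists>A. three_cover n k A \<and> non_frankl_complete (generated A)) \<and>
     (\<forall>B. three_cover n (k+1) B \<longrightarrow> frankl_complete (generated B))"

definition NFC3 :: "nat \<Rightarrow> nat" where
  "NFC3 n = (GREATEST k. NFC3_prop n k)"

end

theory Submission
  imports Defs
begin

text \<open>
  Suppose that every element of \<open>\<Union>A\<close> lies in fewer than half of the members of a union-closed
  \<open>F \<supseteq> A\<close>. For a list \<open>vs\<close> of elements let \<open>g x\<close> be the number of members of \<open>F\<close> whose trace on \<open>vs\<close>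
  is \<open>x\<close>. Comparing fibres over the traces gives \<open>g x \<le> g z\<close> when \<open>z\<close> arises from \<open>x\<close> by adding triples
  of \<open>A\<close>, and \<open>g x + g y \<le> g (x \<union> y) + g z\<close> when \<open>z\<close> arises in this way both from \<open>x\<close> and from \<open>y\<close>: the
  fibres over \<open>x\<close> and \<open>y\<close> have their union inside the one over \<open>z\<close> and their intersection inside the one
  over \<open>x \<union> y\<close>. For fourteen small configurations of triples, a nonnegative combination of such
  inequalities says that a positively weighted sum of the surpluses \<open>2 * card {X\<in>F. v \<in> X} - card F\<close>
  is nonnegative, so \<open>A\<close> contains none of them.

  In particular no element lies in three triples. If each element of a triple lies in another triple,
  then two of them lie in the same other triple, and a chain of triples leaving through the third
  element ends after at most two steps in a triple with at most one element of degree two.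
  Discharging along these chains, a triple has at most two elements of degree two on average, and
  counting incidences yields \<open>2 * card A \<le> card (\<Union>A)\<close>.
\<close>

section \<open>Linear certificates\<close>

datatype ctree = Leaf | Node int ctree ctree

fun ctree_add :: "int \<Rightarrow> bool list \<Rightarrow> ctree \<Rightarrow> ctree" where
  "ctree_add c [] Leaf = Node c Leaf Leaf"
| "ctree_add c [] (Node d l r) = Node (c + d) l r"
| "ctree_add c (False # bs) Leaf = Node 0 (ctree_add c bs Leaf) Leaf"
| "ctree_add c (True # bs) Leaf = Node 0 Leaf (ctree_add c bs Leaf)"
| "ctree_add c (False # bs) (Node d l r) = Node d (ctree_add c bs l) r"
| "ctree_add c (True # bs) (Node d l r) = Node d l (ctree_add c bs r)"

fun ctree_plus :: "ctree \<Rightarrow> ctree \<Rightarrow> ctree" where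
  "ctree_plus Leaf t = t"
| "ctree_plus t Leaf = t"
| "ctree_plus (Node c l r) (Node d l' r') = Node (c + d) (ctree_plus l l') (ctree_plus r r')"

text \<open>The trie is a sparse linear form: a node holds the coefficient of the bit vector spelled
  by the path to it, \<open>False\<close> going left, and \<open>Leaf\<close> stands for a whole
  subtree of zero coefficients.\<close>

fun ctree_val :: "(bool list \<Rightarrow> int) \<Rightarrow> ctree \<Rightarrow> int" where
  "ctree_val g Leaf = 0"
| "ctree_val g (Node d l r) =
     d * g [] + ctree_val (\<lambda>x. g (False # x)) l + ctree_val (\<lambda>x. g (True # x)) r"

lemma ctree_val_add: "ctree_val g (ctree_add c x t) = ctree_val g t + c * g x"
  by (induction c x t arbitrary: g rule: ctree_add.induct) (auto simp: algebra_simps)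

lemma ctree_val_plus: "ctree_val g (ctree_plus s t) = ctree_val g s + ctree_val g t"
  by (induction s t arbitrary: g rule: ctree_plus.induct) (auto simp: algebra_simps)

text \<open>Unfolded, each bit vector \<open>x\<close> of length \<open>length ws\<close> gets as
  coefficient \<open>a\<close> plus the weights at its \<open>True\<close> positions minus those at
  its \<open>False\<close> positions. Carrying the partial sum in \<open>a\<close> lets the
  recursion run in parallel with a trie.\<close>

fun signed_sum :: "int list \<Rightarrow> int \<Rightarrow> (bool list \<Rightarrow> int) \<Rightarrow> int" where
  "signed_sum [] a g = a * g []"
| "signed_sum (w # ws) a g =
     signed_sum ws (a - w) (\<lambda>x. g (False # x)) + signed_sum ws (a + w) (\<lambda>x. g (True # x))"

text \<open>Coefficientwise domination by the form behind \<open>signed_sum\<close>. An early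
  \<open>Leaf\<close> still branches, since its zero coefficients must lie below every completed
  signed weight. Nonzero coefficients at bit vectors of any length other than
  \<open>length ws\<close> are rejected.\<close>

fun ctree_le :: "ctree \<Rightarrow> int list \<Rightarrow> int \<Rightarrow> bool" where
  "ctree_le Leaf [] a \<longleftrightarrow> 0 \<le> a"
| "ctree_le (Node d l r) [] a \<longleftrightarrow> d \<le> a \<and> l = Leaf \<and> r = Leaf"
| "ctree_le Leaf (w # ws) a \<longleftrightarrow> ctree_le Leaf ws (a - w) \<and> ctree_le Leaf ws (a + w)"
| "ctree_le (Node d l r) (w # ws) a \<longleftrightarrow>
     d = 0 \<and> ctree_le l ws (a - w) \<and> ctree_le r ws (a + w)"

text \<open>Since \<open>g\<close> is nonnegative, raising coefficients can only raise the value of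
  the form; both sides are compared branch by branch.\<close>

lemma ctree_val_le:
  assumes "ctree_le t ws a" and "\<And>x. g x \<ge> 0"
  shows "ctree_val g t \<le> signed_sum ws a g"
  using assms
proof (induction t ws a arbitrary: g rule: ctree_le.induct)
  case (1 a)
  then show ?case by simp
next
  case (2 d l r a)
  then show ?case by (auto intro: mult_right_mono)
next
  case (3 w ws a)
  have "ctree_val (\<lambda>x. g (False # x)) Leaf \<le> signed_sum ws (a - w) (\<lambda>x. g (False # x))"
    using 3 by simp
  moreover have "ctree_val (\<lambda>x. g (True # x)) Leaf \<le> signed_sum ws (a + w) (\<lambda>x. g (True # x))"
    using 3 by simp
  ultimately show ?case by simp
next
  case (4 d l r w ws a)
  have "ctree_val (\<lambda>x. g (False # x)) l \<le> signed_sum ws (a - w) (\<lambda>x. g (False # x))"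
    using 4 by simp
  moreover have "ctree_val (\<lambda>x. g (True # x)) r \<le> signed_sum ws (a + w) (\<lambda>x. g (True # x))"
    using 4 by simp
  moreover have "d = 0" using "4.prems" by simp
  ultimately show ?case by simp
qed

section \<open>Bit vectors, their integer codes, and certificates\<close>

fun bor :: "bool list \<Rightarrow> bool list \<Rightarrow> bool list" where
  "bor (False # xs) (y # ys) = y # bor xs ys"
| "bor (True # xs) (y # ys) = True # bor xs ys"
| "bor _ _ = []"

text \<open>A bit mask picks the triples that are joined to \<open>x\<close>, so that a certificate
  entry can be written with integers alone.\<close>

fun absorb :: "bool list list \<Rightarrow> bool list \<Rightarrow> bool list \<Rightarrow> bool list" where
  "absorb (t # ts) (True # ms) x = absorb ts ms (bor x t)"
| "absorb (t # ts) (False # ms) x = absorb ts ms x"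
| "absorb _ _ x = x"

text \<open>A set of positions is coded by an integer whose leading binary digit is only a sentinel.\<close>

function bits :: "int \<Rightarrow> bool list" where
  "bits k = (if k \<le> 1 then [] else odd k # bits (k div 2))"
  by auto
termination by (relation "measure nat") auto

declare bits.simps [simp del]

text \<open>With these equations the simplifier decodes literal triples when a certificate is
  applied to named elements.\<close>

lemma bits_numeral [simp]:
  "bits 1 = []"
  "bits (numeral (num.Bit0 m)) = False # bits (numeral m)"
  "bits (numeral (num.Bit1 m)) = True # bits (numeral m)"
  by (subst bits.simps; simp)+

text \<open>Recursion on the constructors of integers lets \<open>code_simp\<close> peel off one
  binary digit per step instead of evaluating \<open>div\<close>.\<close>

lemma bits_code [code]:
  "bits (Int.Pos num.One) = []"
  "bits (Int.Pos (num.Bit0 m)) = False # bits (Int.Pos m)"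
  "bits (Int.Pos (num.Bit1 m)) = True # bits (Int.Pos m)"
  "bits (Int.Neg k) = []"
  "bits 0 = []"
  by (subst bits.simps; simp)+

text \<open>
  \<open>Mono c x m\<close> is \<open>c\<close> times the inequality \<open>g x \<le> g z\<close> and \<open>Join c x m y l\<close> is \<open>c\<close> times
  \<open>g x + g y \<le> g (x \<union> y) + g z\<close>, where \<open>z\<close> is the union of \<open>x\<close> with the triples selected by \<open>m\<close>
  (and of \<open>y\<close> with those selected by \<open>l\<close>).
\<close>

datatype entry = Mono int int int | Join int int int int int

fun entry_ok :: "bool list list \<Rightarrow> entry \<Rightarrow> bool" where
  "entry_ok ts (Mono c x m) \<longleftrightarrow> 0 \<le> c"
| "entry_ok ts (Join c x m y l) \<longleftrightarrow> 0 \<le> c \<and> absorb ts (bits m) (bits x) = absorb ts (bits l) (bits y)"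

text \<open>The form grows by \<open>c\<close> times the right side minus the left side of the
  inequality, so its value on fibre counts cannot decrease.\<close>

fun entry_add :: "bool list list \<Rightarrow> entry \<Rightarrow> ctree \<Rightarrow> ctree" where
  "entry_add ts (Mono c x m) t =
     ctree_add c (absorb ts (bits m) (bits x)) (ctree_add (- c) (bits x) t)"
| "entry_add ts (Join c x m y l) t =
     ctree_add c (bor (bits x) (bits y)) (ctree_add c (absorb ts (bits m) (bits x))
       (ctree_add (- c) (bits x) (ctree_add (- c) (bits y) t)))"

fun block_tree :: "bool list list \<Rightarrow> entry list \<Rightarrow> ctree \<Rightarrow> ctree" where
  "block_tree ts [] t = t"
| "block_tree ts (e # es) t = block_tree ts es (entry_add ts e t)"

fun cert_tree :: "bool list list \<Rightarrow> entry list list \<Rightarrow> ctree" where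
  "cert_tree ts [] = Leaf"
| "cert_tree ts (es # ess) = ctree_plus (block_tree ts es Leaf) (cert_tree ts ess)"

text \<open>The final offset \<open>0\<close> is the one for which \<open>signed_sum\<close> is
  exactly the weighted surplus. Positive weights on a nonempty list make that surplus strictly
  negative once all elements are rare. Every condition can be decided by evaluation.\<close>

definition cert_ok :: "int list \<Rightarrow> int list \<Rightarrow> entry list list \<Rightarrow> bool" where
  "cert_ok ts ws ess \<longleftrightarrow> ws \<noteq> [] \<and> list_all (\<lambda>w. 0 < w) ws \<and>
     list_all (\<lambda>t. length (bits t) = length ws) ts \<and>
     list_all (list_all (entry_ok (map bits ts))) ess \<and>
     ctree_le (cert_tree (map bits ts) ess) ws 0"

section \<open>Traces of sets on a list of elements\<close>

fun sel :: "'a list \<Rightarrow> bool list \<Rightarrow> 'a set" where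
  "sel (v # vs) (b # bs) = (if b then insert v (sel vs bs) else sel vs bs)"
| "sel _ _ = {}"

lemma sel_subset: "sel vs bs \<subseteq> set vs"
  by (induction vs bs rule: sel.induct) auto

abbreviation trace :: "'a list \<Rightarrow> 'a set \<Rightarrow> bool list" where
  "trace vs X \<equiv> map (\<lambda>v. v \<in> X) vs"

lemma bor_Cons: "bor (x # xs) (y # ys) = (x \<or> y) # bor xs ys"
  by (cases x) auto

lemma trace_Un: "trace vs (X \<union> Y) = bor (trace vs X) (trace vs Y)"
  by (induction vs) (auto simp: bor_Cons)

text \<open>\<open>sel\<close> decodes a bit vector against the names in \<open>vs\<close>, and the
  trace encodes it again; distinctness keeps one name from setting two positions. For
  \<open>vs = [a,b,c,d]\<close> the code \<open>23\<close>, in binary 10111, is read from the lowest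
  digit upwards and gives \<open>{a,b,c}\<close>.\<close>

lemma trace_sel:
  assumes "distinct vs" "length bs = length vs"
  shows "trace vs (sel vs bs) = bs"
proof -
  have "length vs = length bs" using assms(2) by simp
  then show ?thesis using assms(1)
  proof (induction vs bs rule: list_induct2)
    case Nil
    then show ?case by simp
  next
    case (Cons v vs b bs)
    have "v \<notin> sel vs bs" using sel_subset[of vs bs] Cons by auto
    moreover have "trace vs (insert v (sel vs bs)) = trace vs (sel vs bs)"
      unfolding map_eq_conv using Cons by auto
    moreover have "trace vs (sel vs bs) = bs" using Cons by simp
    ultimately show ?case by (simp del: insert_iff) auto
  qed
qed

text \<open>Induction along \<open>vs\<close>: \<open>F\<close> splits into the members without and
  with the head \<open>v\<close>, whose offsets change by \<open>- w\<close> and \<open>w\<close>.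
  The difference of the two cardinalities is the surplus of \<open>v\<close>, and the surpluses of
  the later elements add up over the two parts.\<close>

lemma signed_sum_count:
  fixes F :: "'a set set"
  assumes "length ws = length vs" "finite F"
  shows "signed_sum ws a (\<lambda>x. int (card {X\<in>F. trace vs X = x})) =
    a * int (card F) + (\<Sum>(w, v)\<leftarrow>zip ws vs. w * (2 * int (card {X\<in>F. v \<in> X}) - int (card F)))"
  using assms
proof (induction ws vs arbitrary: a F rule: list_induct2)
  case Nil
  then show ?case by simp
next
  case (Cons w ws v vs)
  define F0 where "F0 = {X\<in>F. v \<notin> X}"
  define F1 where "F1 = {X\<in>F. v \<in> X}"
  have fin: "finite F0" "finite F1" using Cons.prems by (auto simp: F0_def F1_def)
  have "F = F0 \<union> F1" "F0 \<inter> F1 = {}" by (auto simp: F0_def F1_def)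
  then have cF: "card F = card F0 + card F1" using fin card_Un_disjoint by metis
  have cu: "card {X\<in>F. u \<in> X} = card {X\<in>F0. u \<in> X} + card {X\<in>F1. u \<in> X}" for u
  proof -
    have "{X\<in>F. u \<in> X} = {X\<in>F0. u \<in> X} \<union> {X\<in>F1. u \<in> X}" by (auto simp: F0_def F1_def)
    moreover have "{X\<in>F0. u \<in> X} \<inter> {X\<in>F1. u \<in> X} = {}" by (auto simp: F0_def F1_def)
    ultimately show ?thesis using fin by (simp add: card_Un_disjoint)
  qed
  have e: "(\<lambda>x. int (card {X\<in>F. trace (v # vs) X = False # x})) = (\<lambda>x. int (card {X\<in>F0. trace vs X = x}))"
    "(\<lambda>x. int (card {X\<in>F. trace (v # vs) X = True # x})) = (\<lambda>x. int (card {X\<in>F1. trace vs X = x}))"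
    by (auto simp: F0_def F1_def intro!: ext arg_cong[where f=card])
  have "(\<Sum>(w, v)\<leftarrow>zip ws vs. w * (2 * int (card {X\<in>F. v \<in> X}) - int (card F))) =
    (\<Sum>(w, v)\<leftarrow>zip ws vs. w * (2 * int (card {X\<in>F0. v \<in> X}) - int (card F0))) +
    (\<Sum>(w, v)\<leftarrow>zip ws vs. w * (2 * int (card {X\<in>F1. v \<in> X}) - int (card F1)))"
    unfolding sum_list_addf[symmetric] case_prod_unfold
    by (simp add: cu cF algebra_simps)
  moreover have "card {X\<in>F. v \<in> X} = card F1" by (simp add: F1_def)
  ultimately show ?case
    using Cons.IH[OF fin(1), of "a - w"] Cons.IH[OF fin(2), of "a + w"] cF
    by (simp add: e[simplified] algebra_simps)
qed

section \<open>Fibres of a union-closed family over its traces\<close>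

locale uc_family =
  fixes F :: "'a set set"
  assumes fin: "finite F" and Un: "\<lbrakk>X \<in> F; Y \<in> F\<rbrakk> \<Longrightarrow> X \<union> Y \<in> F"
begin

text \<open>Deleting \<open>set vs\<close> moves the fibres over different traces into one common
  universe, where they can be compared by inclusion and intersected.\<close>

definition fibre :: "'a list \<Rightarrow> bool list \<Rightarrow> 'a set set" where
  "fibre vs x = (\<lambda>X. X - set vs) ` {X\<in>F. trace vs X = x}"

lemma finite_fibre: "finite (fibre vs x)"
  using fin by (simp add: fibre_def)

text \<open>A member is determined by its trace together with its part outside \<open>vs\<close>, so
  the deletion is injective on each fibre.\<close>

lemma card_fibre: "card (fibre vs x) = card {X\<in>F. trace vs X = x}"
  unfolding fibre_def
proof (rule card_image, rule inj_onI)
  fix X Y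
  assume "X \<in> {X\<in>F. trace vs X = x}" "Y \<in> {X\<in>F. trace vs X = x}"
  then have "trace vs X = trace vs Y" by simp
  then have "\<forall>v\<in>set vs. v \<in> X \<longleftrightarrow> v \<in> Y" by simp
  moreover assume "X - set vs = Y - set vs"
  ultimately show "X = Y" by blast
qed

text \<open>If the same remainder \<open>Z\<close> occurs over \<open>x\<close> and over
  \<open>y\<close>, the union of the two members again has remainder \<open>Z\<close>, and its trace
  is the join.\<close>

lemma fibre_bor: "fibre vs x \<inter> fibre vs y \<subseteq> fibre vs (bor x y)"
proof
  fix Z
  assume "Z \<in> fibre vs x \<inter> fibre vs y"
  then obtain X Y where "X \<in> F" "Y \<in> F" "trace vs X = x" "trace vs Y = y"
    "X - set vs = Z" "Y - set vs = Z"
    by (auto simp: fibre_def)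
  then have "X \<union> Y \<in> F" "trace vs (X \<union> Y) = bor x y" "(X \<union> Y) - set vs = Z"
    unfolding trace_Un using Un by auto
  then show "Z \<in> fibre vs (bor x y)" unfolding fibre_def by blast
qed

text \<open>The selected triples are members of \<open>F\<close> inside \<open>set vs\<close>, so
  joining one of them changes the trace and keeps the remainder.\<close>

lemma fibre_absorb:
  assumes "distinct vs" "\<forall>t\<in>set ts. length t = length vs \<and> sel vs t \<in> F"
  shows "fibre vs x \<subseteq> fibre vs (absorb ts ms x)"
  using assms(2)
proof (induction ts ms x rule: absorb.induct)
  case (1 t ts ms x)
  have "fibre vs x \<subseteq> fibre vs (bor x t)"
  proof
    fix Z
    assume "Z \<in> fibre vs x"
    then obtain X where X: "X \<in> F" "trace vs X = x" "X - set vs = Z"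
      by (auto simp: fibre_def)
    have "trace vs (sel vs t) = t" using trace_sel assms(1) 1 by auto
    then have "X \<union> sel vs t \<in> F" "trace vs (X \<union> sel vs t) = bor x t" "(X \<union> sel vs t) - set vs = Z"
      unfolding trace_Un using X Un 1 sel_subset[of vs t] by auto
    then show "Z \<in> fibre vs (bor x t)" unfolding fibre_def by blast
  qed
  then show ?case using 1 by fastforce
qed auto

text \<open>\<open>Mono\<close> is inclusion of fibres. For \<open>Join\<close>, the two
  cardinalities sum to those of the union and the intersection; the union lies in the fibre over the
  common target and the intersection in the fibre over the joined trace.\<close>

lemma entry_val:
  assumes "distinct vs" "\<forall>t\<in>set ts. length t = length vs \<and> sel vs t \<in> F" "entry_ok ts e"
  shows "ctree_val (\<lambda>x. int (card (fibre vs x))) t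
    \<le> ctree_val (\<lambda>x. int (card (fibre vs x))) (entry_add ts e t)"
proof (cases e)
  case (Mono c x m)
  have "card (fibre vs (bits x)) \<le> card (fibre vs (absorb ts (bits m) (bits x)))"
    by (rule card_mono[OF finite_fibre fibre_absorb[OF assms(1,2)]])
  then have "c * int (card (fibre vs (bits x)))
      \<le> c * int (card (fibre vs (absorb ts (bits m) (bits x))))"
    using Mono assms(3) by (intro mult_left_mono) auto
  then show ?thesis using Mono by (simp add: ctree_val_add)
next
  case (Join c x m y l)
  let ?f = "fibre vs" and ?z = "absorb ts (bits m) (bits x)"
  \<comment> \<open>\<open>entry_ok\<close> guarantees that both absorptions end in the same bit
    vector \<open>?z\<close>.\<close>
  have "?f (bits x) \<union> ?f (bits y) \<subseteq> ?f ?z"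
    using Join assms fibre_absorb[OF assms(1,2), of "bits x" "bits m"]
      fibre_absorb[OF assms(1,2), of "bits y" "bits l"] by auto
  then have "card (?f (bits x) \<union> ?f (bits y)) \<le> card (?f ?z)"
    by (rule card_mono[OF finite_fibre])
  moreover have "card (?f (bits x) \<inter> ?f (bits y)) \<le> card (?f (bor (bits x) (bits y)))"
    by (rule card_mono[OF finite_fibre fibre_bor])
  ultimately have "card (?f (bits x)) + card (?f (bits y))
      \<le> card (?f ?z) + card (?f (bor (bits x) (bits y)))"
    using card_Un_Int[OF finite_fibre finite_fibre, of vs "bits x" vs "bits y"] by linarith
  then have "c * (int (card (?f (bits x))) + int (card (?f (bits y))))
      \<le> c * (int (card (?f ?z)) + int (card (?f (bor (bits x) (bits y)))))"
    using Join assms(3) by (intro mult_left_mono) auto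
  then show ?thesis using Join by (simp add: ctree_val_add algebra_simps)
qed

text \<open>Each block starts from the zero form and gains a nonnegative amount with every entry;
  the blocks are then added.\<close>

lemma cert_tree_val:
  assumes "distinct vs" "\<forall>t\<in>set ts. length t = length vs \<and> sel vs t \<in> F"
    and "list_all (list_all (entry_ok ts)) ess"
  shows "0 \<le> ctree_val (\<lambda>x. int (card (fibre vs x))) (cert_tree ts ess)"
  using assms(3)
proof (induction ess)
  case Nil
  then show ?case by simp
next
  case (Cons es ess)
  let ?v = "ctree_val (\<lambda>x. int (card (fibre vs x)))"
  have "?v t \<le> ?v (block_tree ts es t)" if "list_all (entry_ok ts) es" for t
    using that
  proof (induction es arbitrary: t)
    case (Cons e es)
    have "?v t \<le> ?v (entry_add ts e t)" using Cons.prems entry_val[OF assms(1,2)] by simp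
    also have "\<dots> \<le> ?v (block_tree ts es (entry_add ts e t))" using Cons by simp
    finally show ?case by simp
  qed simp
  from this[of Leaf] show ?case using Cons by (simp add: ctree_val_plus)
qed

text \<open>If every listed element had negative surplus, the certified form would be at least 0 and
  at the same time at most a positive combination of negative numbers.\<close>

theorem cert_sound:
  assumes "cert_ok ts ws ess" "distinct vs" "length vs = length ws"
    and "\<forall>t\<in>set ts. sel vs (bits t) \<in> F"
  shows "\<exists>v\<in>set vs. card F \<le> 2 * card {X\<in>F. v \<in> X}"
proof (rule ccontr)
  assume "\<not> ?thesis"
  then have neg: "2 * int (card {X\<in>F. v \<in> X}) - int (card F) < 0" if "v \<in> set vs" for v
    using that by force
  let ?g = "\<lambda>x. int (card (fibre vs x))"
  have ts: "\<forall>t\<in>set (map bits ts). length t = length vs \<and> sel vs t \<in> F"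
    using assms by (auto simp: cert_ok_def list_all_iff)
  have "0 \<le> ctree_val ?g (cert_tree (map bits ts) ess)"
    using cert_tree_val[OF assms(2) ts, of ess] assms(1) by (simp add: cert_ok_def)
  also have "\<dots> \<le> signed_sum ws 0 ?g"
    using assms(1) by (intro ctree_val_le) (auto simp: cert_ok_def)
  also have "\<dots> = (\<Sum>(w, v)\<leftarrow>zip ws vs. w * (2 * int (card {X\<in>F. v \<in> X}) - int (card F)))"
    unfolding card_fibre using signed_sum_count[OF assms(3)[symmetric] fin, of 0] by simp
  \<comment> \<open>The heads of the two lists provide strictness; the tails, possibly empty, only
    need the weak inequality.\<close>
  also have "\<dots> < (\<Sum>(w, v)\<leftarrow>zip ws vs. 0)"
  proof -
    obtain w ws' v vs' where e: "ws = w # ws'" "vs = v # vs'"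
      using assms by (cases ws; cases vs) (auto simp: cert_ok_def)
    have 1: "w' * (2 * int (card {X\<in>F. v' \<in> X}) - int (card F)) < 0"
      if "(w', v') \<in> set (zip ws vs)" for w' v'
      using that neg assms(1) set_zip_leftD[OF that] set_zip_rightD[OF that]
      by (auto simp: cert_ok_def list_all_iff mult_pos_neg)
    have "(\<Sum>(w, v)\<leftarrow>zip ws' vs'. w * (2 * int (card {X\<in>F. v \<in> X}) - int (card F)))
        \<le> (\<Sum>(w, v)\<leftarrow>zip ws' vs'. 0)"
      by (rule sum_list_mono) (use 1 e in force)
    then show ?thesis using 1[of w v] e by simp
  qed
  finally show False by (simp add: case_prod_unfold)
qed

end

section \<open>Certificates for fourteen configurations\<close>

text \<open>
  Weights and multipliers come from a linear program. The split into blocks has no meaning: summing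
  short blocks separately keeps the rewritten terms small.
\<close>

lemma cert_three_on_four: "cert_ok [23, 27, 29] [1, 1, 1, 1] [
    [Mono 2 16 10, Mono 2 17 9, Join 2 18 12 20 10, Join 2 22 10 24 9, Mono 2 16 12]]"
  by code_simp

text \<open>With positions named a, b, c and so on, the triples are abc, abd, abe. The elements of
  the common pair carry the larger weight.\<close>

lemma cert_common_pair: "cert_ok [39, 43, 51] [3, 3, 2, 2, 2] [
    [Mono 4 32 12, Join 4 33 14 40 12, Join 2 44 9 34 11, Join 2 36 12 33 13, Join 4 37 12 48 9,
     Join 2 38 14 56 9, Mono 4 32 9, Join 2 40 13 53 10, Join 2 42 13 52 10, Mono 4 32 10,
     Join 2 52 9 34 13, Join 4 48 11 45 12, Join 2 50 11 44 12, Join 6 36 10 41 9,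
     Join 2 40 12 49 10, Join 2 56 10 34 14]]"
  by code_simp

text \<open>The triples abc, bcd, cde are the windows of length three on a line; the weights respect
  its reversal.\<close>

lemma cert_tight_path: "cert_ok [39, 46, 60] [2, 3, 4, 3, 2] [
    [Mono 1 32 12, Join 3 44 9 33 10, Join 1 57 9 34 13, Mono 4 35 9, Join 3 36 14 40 14,
     Join 1 37 12 41 12, Join 5 33 13 40 13, Join 3 50 11 41 13, Join 2 33 13 42 13,
     Join 1 49 12 37 12, Mono 7 46 9, Mono 13 32 10, Mono 7 48 9, Mono 1 49 12, Join 1 50 9 49 9,
     Mono 4 41 12, Join 1 49 10 52 11, Join 4 52 10 34 12, Join 1 56 9 51 10, Join 3 34 12 56 10,
     Join 1 49 12 41 12, Join 1 58 9 49 10, Join 3 36 12 48 12]]"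
  by code_simp

lemma cert_near_star: "cert_ok [71, 75, 113] [10, 8, 5, 5, 5, 5] [
    [Mono 2 64 12, Join 4 65 11 68 10, Mono 16 66 12, Mono 2 67 12, Join 8 82 13 65 13,
     Join 7 69 12 100 12, Join 5 70 14 112 11, Mono 5 71 12, Mono 12 72 12, Join 4 100 14 73 13,
     Join 1 66 10 72 10, Mono 23 64 10, Join 4 68 14 72 13, Join 2 68 14 73 13,
     Join 4 78 12 120 9, Join 2 120 9 68 14, Mono 13 80 9, Join 8 81 11 84 10, Join 4 92 9 82 11,
     Join 7 70 10 72 9, Mono 5 84 9, Join 5 84 12 69 12, Join 2 88 9 86 10, Mono 15 80 10,
     Mono 3 88 10, Join 2 88 14 73 14, Join 2 92 9 90 9, Join 11 85 10 88 9, Mono 1 92 9,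
     Join 1 65 15 92 13],
    [Mono 13 96 9, Join 2 97 14 72 14, Join 4 98 13 68 13, Join 3 97 10 98 10,
     Join 2 100 10 106 9, Join 8 108 9 101 10, Join 6 102 10 104 9, Mono 5 100 9, Mono 12 104 9,
     Join 3 97 13 68 13, Mono 15 96 10, Join 5 65 13 98 13, Mono 9 75 12, Join 2 114 11 72 13,
     Join 2 120 10 66 14, Join 5 78 12 116 10, Join 13 74 12 112 10, Join 3 116 9 66 13,
     Mono 13 64 9, Join 9 122 9 68 14, Mono 22 76 12, Mono 7 75 9]]"
  by code_simp

text \<open>The triples abc, abd, cde: the last one joins the free elements of two triples on a
  common pair.\<close>

lemma cert_closed_pair: "cert_ok [39, 43, 60] [6, 6, 6, 6, 3] [
    [Mono 24 32 10, Join 7 40 13 33 13, Join 5 34 11 36 10, Join 3 35 12 48 11, Mono 10 34 12,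
     Join 8 41 12 37 12, Mono 4 36 9, Join 8 38 13 40 13, Join 3 33 13 56 9, Join 2 41 13 44 13,
     Join 1 42 9 44 9, Mono 15 43 9, Join 2 42 12 50 12, Mono 1 45 12, Join 5 33 9 36 9,
     Mono 3 32 12, Mono 9 48 10, Join 2 52 9 49 9, Join 1 56 10 50 10, Mono 4 52 9, Mono 6 49 12,
     Join 3 50 11 52 10, Mono 9 48 9, Mono 3 50 12, Join 1 36 13 49 11, Mono 5 56 10]]"
  by code_simp

text \<open>The triples abc, cde, aef form a cycle whose corners a, c, e weigh twice the other
  elements.\<close>

lemma cert_triangle: "cert_ok [71, 92, 113] [4, 2, 4, 2, 4, 2] [
    [Mono 15 64 10, Join 2 65 13 80 13, Mono 2 66 9, Join 3 88 9 67 10, Join 2 112 9 68 13,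
     Join 2 69 12 84 12, Join 4 112 9 70 12, Join 6 121 9 66 14, Mono 1 72 10, Mono 2 73 10,
     Mono 4 74 9, Join 1 90 12 75 12, Join 4 76 12 97 10, Join 2 73 9 76 9, Join 2 96 11 78 12,
     Join 2 99 10 74 13, Mono 8 65 10, Mono 6 80 9, Mono 4 82 9, Join 2 82 11 67 10,
     Join 4 68 15 81 15, Join 2 80 13 70 12, Join 1 88 9 75 10, Join 2 88 14 73 14,
     Mono 13 72 12, Mono 6 66 10, Mono 8 92 9, Mono 6 96 10, Join 2 100 13 97 13,
     Join 1 121 9 98 11],
    [Join 2 120 9 74 13, Mono 4 100 12, Join 2 102 10 114 10, Mono 6 96 9, Mono 10 104 9,
     Join 2 108 12 105 10, Mono 6 106 10, Mono 4 68 12, Mono 1 113 9, Mono 7 98 12, Mono 3 64 12,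
     Mono 2 74 12, Mono 2 98 10, Join 1 90 13 67 14, Mono 6 92 12, Mono 1 115 9]]"
  by code_simp

text \<open>The triples abc, ade, afg meet in a only, and this centre has double weight.\<close>

lemma cert_star: "cert_ok [135, 153, 225] [2, 1, 1, 1, 1, 1, 1] [
    [Mono 6 128 10, Join 2 129 15 202 15, Mono 2 130 10, Join 2 170 14 131 14, Mono 4 132 10,
     Join 2 133 12 196 12, Join 4 248 9 134 14, Mono 2 135 12, Mono 4 136 9,
     Join 2 204 13 137 13, Mono 4 138 12, Mono 2 140 12, Join 2 141 12 172 12,
     Join 2 142 12 232 9, Mono 2 143 12, Mono 4 144 12, Join 2 145 13 180 13, Mono 4 146 12,
     Mono 4 148 12, Join 2 150 12 240 9, Mono 2 144 9, Join 4 152 12 224 10, Mono 6 153 9,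
     Join 2 226 10 154 12, Mono 4 130 12, Join 2 156 12 228 10, Join 2 140 10 133 10,
     Mono 2 159 12, Mono 2 160 9, Join 2 161 11 162 11],
    [Mono 2 162 10, Join 2 163 10 178 10, Mono 4 164 10, Join 2 184 9 166 10, Mono 4 160 10,
     Mono 4 168 9, Mono 4 157 12, Mono 4 176 9, Mono 2 185 9, Mono 2 192 10,
     Join 2 193 11 210 11, Mono 4 194 10, Mono 2 196 10, Join 2 212 10 197 10,
     Join 2 198 10 216 9, Mono 4 192 9, Mono 4 200 9, Join 2 132 13 129 13, Mono 4 208 9,
     Mono 2 199 10, Mono 2 227 10, Mono 2 128 9, Mono 2 136 12, Mono 2 241 9]]"
  by code_simp

text \<open>The body abc with legs ade, bfg, chi, one at each of its elements; body elements have
  double weight.\<close>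

lemma cert_spider: "cert_ok [519, 537, 610, 900] [2, 2, 2, 1, 1, 1, 1, 1, 1] [
    [Mono 12 512 18, Join 2 513 30 1000 19, Join 4 924 17 514 26, Join 4 515 28 896 21,
     Join 2 536 21 516 22, Join 4 608 17 517 20, Join 2 518 24 770 24, Mono 10 520 17,
     Join 2 522 25 521 25, Join 3 1004 17 521 28, Join 2 523 24 904 17, Mono 2 524 20,
     Join 2 777 24 525 24, Join 2 778 24 526 24, Mono 8 527 20, Mono 6 528 17, Mono 2 529 20,
     Join 2 513 19 530 19, Join 2 944 21 530 29, Join 4 532 29 880 25, Join 2 533 20 624 17,
     Join 2 534 20 564 20, Mono 2 535 24, Mono 2 536 20, Mono 4 537 24, Join 2 538 28 952 28,
     Join 1 539 28 960 23, Mono 2 540 20, Join 1 889 25 541 28, Join 2 516 19 538 17],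
    [Mono 6 543 20, Mono 2 544 17, Mono 2 545 24, Join 2 546 25 929 17, Join 2 547 24 928 17,
     Join 1 548 27 824 25, Join 2 549 18 556 18, Join 3 550 18 568 17, Mono 1 544 18,
     Mono 4 552 17, Mono 2 553 24, Join 2 554 19 545 19, Join 4 555 24 936 17,
     Join 2 522 21 556 21, Join 2 557 24 681 24, Join 2 558 24 810 24, Mono 4 552 24,
     Mono 8 560 17, Join 2 561 25 562 25, Mono 2 561 24, Mono 2 562 24, Join 2 564 26 545 26,
     Join 2 565 24 817 24, Join 2 566 24 690 24, Mono 4 567 24, Mono 2 568 24, Mono 7 544 24,
     Mono 2 570 24, Join 2 569 28 514 30, Join 2 542 20 572 20],
    [Join 3 574 24 826 24, Mono 1 569 17, Mono 9 576 17, Mono 2 577 24, Join 1 985 17 578 26,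
     Join 2 579 26 960 19, Mono 1 580 18, Join 2 588 18 581 18, Join 1 518 20 580 20,
     Mono 4 583 24, Mono 8 584 17, Join 2 522 21 585 21, Mono 4 586 24, Join 2 585 25 588 25,
     Join 2 587 24 968 17, Join 2 589 24 713 24, Mono 4 591 24, Mono 8 592 17, Mono 4 593 24,
     Mono 4 594 24, Join 2 721 25 596 25, Mono 4 599 24, Join 3 600 17 582 18,
     Join 1 601 20 514 22, Mono 5 602 24, Mono 1 578 18, Join 2 856 24 604 24,
     Join 4 730 25 580 27, Join 1 606 24 858 24, Mono 3 583 18],
    [Mono 4 608 18, Mono 4 609 24, Mono 3 610 24, Join 4 736 24 612 24, Join 2 613 18 620 18,
     Join 2 614 26 890 25, Mono 6 616 24, Mono 2 617 24, Mono 2 618 24, Join 1 619 24 904 21,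
     Join 2 613 18 628 18, Join 4 524 28 650 28, Mono 6 623 24, Mono 2 624 24,
     Join 2 529 28 624 25, Mono 2 626 17, Mono 2 529 24, Join 2 629 24 753 24, Mono 2 535 20,
     Mono 4 632 24, Mono 4 633 24, Mono 2 634 24, Mono 2 537 20, Join 2 762 24 540 28,
     Mono 10 537 17, Mono 8 640 17, Join 2 752 19 641 23, Join 4 668 17 642 19,
     Join 2 643 18 658 18, Join 2 664 17 644 19],
    [Join 2 645 18 652 18, Join 2 646 22 664 21, Mono 2 640 18, Mono 6 648 17,
     Join 2 649 21 652 21, Mono 2 649 20, Join 4 653 20 744 17, Join 2 654 20 684 20,
     Mono 2 648 20, Mono 8 656 17, Mono 2 657 20, Join 2 660 17 658 17, Join 2 659 20 689 20,
     Mono 2 660 20, Join 2 752 17 661 20, Join 2 724 20 662 20, Mono 6 663 20,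
     Join 2 737 17 644 21, Mono 4 665 20, Join 4 728 20 666 20, Join 4 700 20 670 20,
     Join 2 664 21 642 23, Mono 4 672 17, Join 2 673 19 676 19, Mono 4 674 18, Mono 2 676 18,
     Join 2 673 19 682 19, Mono 4 672 18, Mono 6 680 17, Join 2 677 18 692 18],
    [Join 2 654 20 716 20, Mono 6 688 17, Join 4 696 26 548 26, Mono 4 697 17, Mono 4 704 18,
     Join 2 722 19 705 19, Join 2 705 19 706 19, Join 2 707 18 714 18, Mono 4 708 18,
     Mono 4 704 17, Mono 6 712 17, Join 2 589 24 841 24, Mono 2 706 18, Mono 6 720 17,
     Join 2 848 25 596 25, Mono 4 729 17, Join 3 600 25 578 26, Mono 2 736 18, Mono 2 644 20,
     Mono 2 738 18, Mono 4 641 20, Mono 6 740 18, Mono 2 743 18, Join 2 746 19 739 19,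
     Mono 2 655 20, Join 2 532 29 657 28, Join 2 760 28 540 28, Join 1 768 25 516 25,
     Mono 6 647 20, Mono 3 768 18],
    [Mono 2 769 20, Join 1 828 21 770 23, Join 2 801 20 771 20, Mono 3 772 18,
     Join 2 773 18 780 18, Join 4 792 17 774 18, Mono 6 768 17, Mono 6 776 17, Mono 2 777 20,
     Join 2 778 21 809 21, Mono 2 780 20, Join 4 872 17 781 20, Join 2 782 20 844 20,
     Mono 2 783 20, Mono 8 784 17, Mono 4 785 20, Join 2 786 21 820 21, Mono 2 788 20,
     Join 2 790 20 852 20, Mono 4 791 20, Mono 2 792 20, Mono 3 793 20, Join 2 856 20 794 20,
     Join 1 795 20 800 22, Mono 2 796 20, Join 3 797 20 864 19, Join 2 798 20 860 20,
     Mono 2 793 17, Mono 3 800 18, Join 2 801 19 808 19],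
    [Join 3 824 17 802 19, Join 2 803 18 818 18, Mono 4 804 18, Mono 4 800 17, Mono 4 808 17,
     Join 2 809 17 812 17, Mono 6 816 17, Join 2 786 21 788 21, Mono 1 802 18, Mono 3 770 18,
     Mono 3 825 17, Join 1 605 24 857 24, Mono 4 832 17, Join 4 833 19 834 19,
     Join 2 835 18 850 18, Mono 3 836 18, Mono 4 832 18, Mono 6 840 17, Join 2 835 18 842 18,
     Mono 4 848 17, Join 2 849 17 852 17, Mono 3 857 17, Join 1 858 17 836 19, Mono 3 864 18,
     Join 2 516 29 865 25, Mono 2 866 17, Join 2 867 18 874 18, Mono 2 868 18, Mono 2 772 20,
     Mono 4 775 20],
    [Join 4 884 19 769 23, Mono 2 776 20, Join 2 888 17 772 22, Mono 1 516 18, Mono 3 896 20,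
     Join 3 1002 18 897 22, Mono 2 898 18, Join 2 899 18 914 18, Mono 1 900 20, Mono 1 513 24,
     Join 1 902 22 568 29, Mono 3 900 17, Mono 3 904 20, Mono 2 905 20, Join 2 906 20 968 20,
     Join 2 523 20 553 20, Mono 2 908 17, Join 4 912 17 531 24, Mono 2 913 20,
     Join 2 899 20 961 20, Join 4 977 20 915 20, Mono 6 916 20, Mono 4 625 24, Mono 2 530 24,
     Mono 2 912 20, Join 2 898 22 920 22, Join 2 984 20 922 20, Mono 2 920 20, Mono 1 514 18,
     Mono 1 601 24],
    [Mono 4 536 24, Mono 4 543 24, Mono 2 928 18, Mono 2 546 24, Mono 2 930 18,
     Join 2 931 18 946 18, Mono 9 932 17, Mono 2 554 24, Mono 2 546 18, Mono 7 935 18,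
     Mono 4 940 17, Join 2 944 17 563 24, Mono 4 528 24, Join 2 571 24 928 19,
     Join 1 902 21 576 29, Mono 3 960 18, Mono 2 962 18, Join 2 963 18 970 18, Mono 2 964 17,
     Join 4 976 26 577 26, Mono 1 578 24, Join 1 518 20 548 20, Mono 1 610 18, Mono 4 992 18,
     Join 1 896 21 513 28, Mono 2 897 20, Mono 4 996 18, Mono 3 994 18, Join 2 513 30 1008 19,
     Mono 1 521 20],
    [Join 1 901 22 1004 19]]"
  by code_simp

text \<open>This certificate and the next two treat abc and abd together with the triple cef through
  c and a triple through d that meets cef in two, one or no elements. The weights are proportional
  to the number of triples containing the element.\<close>

lemma cert_fork6: "cert_ok [71, 75, 116, 120] [5, 5, 5, 5, 5, 5] [
    [Mono 20 64 20, Mono 10 65 20, Join 10 76 17 66 19, Join 10 67 24 112 18,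
     Join 6 106 21 68 25, Mono 10 69 20, Mono 10 70 20, Join 2 72 21 98 25, Join 8 101 24 73 20,
     Mono 10 74 20, Mono 10 75 24, Join 10 72 18 66 18, Join 2 85 24 77 20, Join 10 78 20 90 20,
     Mono 10 80 17, Join 10 81 19 84 18, Join 10 74 24 82 24, Join 8 85 25 72 21, Mono 10 80 18,
     Mono 10 88 17, Mono 6 96 18, Join 10 97 19 100 18, Join 4 104 18 98 18, Join 4 98 19 100 18,
     Join 2 108 17 101 18, Join 4 102 18 104 17, Mono 10 96 17, Join 2 73 21 68 25, Mono 6 68 24,
     Join 2 104 21 68 25],
    [Mono 20 116 17, Mono 10 117 24, Mono 10 64 24, Mono 10 120 17, Mono 10 65 24,
     Join 4 68 24 96 28]]"
  by code_simp

lemma cert_fork7: "cert_ok [135, 139, 180, 216] [54, 54, 54, 54, 54, 27, 27] [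
    [Mono 324 128 18, Join 14 129 21 164 21, Join 130 130 19 132 18, Join 54 131 25 208 19,
     Join 2 132 29 170 25, Join 10 140 21 133 22, Join 24 134 25 136 25, Join 16 129 17 132 17,
     Join 46 145 25 136 25, Mono 70 137 20, Mono 56 138 20, Mono 108 139 24,
     Join 58 144 28 140 28, Mono 16 135 18, Join 20 154 20 142 20, Join 86 130 29 188 25,
     Mono 108 144 17, Mono 140 136 20, Join 44 146 19 148 18, Join 20 152 17 146 19,
     Join 48 141 24 149 24, Join 44 156 17 150 18, Mono 20 144 18, Mono 88 152 18,
     Join 46 148 18 153 17, Mono 162 134 24, Join 38 132 22 137 21, Join 14 156 17 145 19,
     Mono 162 160 18, Join 138 161 19 164 18],
    [Mono 162 162 24, Join 54 163 24 240 18, Mono 24 161 24, Join 92 165 25 168 25,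
     Mono 2 166 20, Mono 54 160 17, Mono 70 165 24, Mono 54 169 20, Join 10 230 24 170 28,
     Join 44 160 28 192 28, Join 54 172 25 193 22, Mono 24 168 17, Mono 38 143 24,
     Join 10 164 25 204 21, Join 10 163 20 176 17, Join 6 177 19 136 21, Join 42 170 28 178 28,
     Join 6 168 28 176 28, Mono 54 180 17, Mono 92 181 24, Join 52 138 28 166 24,
     Join 10 160 21 131 20, Join 48 177 18 184 18, Mono 52 134 20, Join 30 144 21 132 21,
     Mono 114 133 24, Mono 216 139 20, Mono 54 192 17, Mono 14 193 24, Join 54 194 19 196 18],
    [Join 54 224 21 195 20, Mono 54 196 24, Join 44 197 25 204 25, Join 54 198 25 200 25,
     Mono 162 192 20, Mono 54 200 17, Join 44 201 20 165 24, Mono 54 202 24, Mono 10 192 18,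
     Join 54 193 19 196 18, Mono 146 129 20, Join 54 198 28 210 28, Join 10 197 25 200 25,
     Mono 108 208 17, Join 54 209 20 197 20, Mono 108 194 20, Join 44 131 20 176 17,
     Mono 54 212 17, Mono 54 216 18, Join 40 248 17 193 22, Join 48 145 19 148 18,
     Join 12 184 18 178 18, Join 4 146 28 142 28, Join 40 140 29 146 29, Mono 108 224 17,
     Join 10 225 18 232 18, Join 108 226 19 228 18, Join 54 227 24 240 18, Join 98 232 17 230 18,
     Mono 98 224 18],
    [Mono 54 225 20, Join 10 233 17 236 17, Mono 108 171 24, Mono 44 200 18, Mono 10 201 20,
     Mono 162 244 17, Mono 44 225 24, Mono 40 129 24, Mono 38 173 20, Mono 54 250 20,
     Mono 40 168 24, Mono 102 176 18]]"
  by code_simp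

lemma cert_fork8: "cert_ok [263, 267, 308, 456] [6, 6, 6, 6, 3, 3, 3, 3] [
    [Mono 8 256 24, Mono 5 257 20, Join 10 258 19 260 18, Join 12 259 28 496 19,
     Join 4 258 29 460 21, Join 5 261 20 289 20, Join 10 260 25 265 25, Join 6 264 29 389 29,
     Join 6 262 25 264 25, Join 6 326 28 266 28, Join 12 268 20 280 20, Mono 2 265 20,
     Join 6 270 20 282 20, Join 2 264 17 258 19, Mono 6 272 17, Join 18 273 25 284 25,
     Join 12 274 19 276 18, Join 6 275 24 464 18, Mono 6 276 24, Mono 6 277 24, Mono 12 278 24,
     Mono 6 272 18, Join 6 278 18 280 17, Join 6 281 24 337 24, Join 8 490 20 262 28,
     Mono 18 272 24, Join 6 405 24 285 24, Join 6 286 24 406 24, Mono 6 274 24, Mono 11 288 18],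
    [Mono 2 261 24, Join 4 300 17 290 19, Join 6 291 24 480 18, Join 5 489 17 292 25,
     Mono 11 289 24, Mono 6 294 24, Mono 13 295 18, Join 11 293 25 296 25, Join 1 297 17 292 18,
     Join 6 292 25 298 25, Mono 19 288 17, Join 2 300 25 289 25, Join 8 301 24 357 24,
     Join 4 302 24 358 24, Mono 14 290 24, Mono 24 304 18, Join 6 312 26 305 26, Mono 12 306 24,
     Mono 12 308 24, Mono 19 257 24, Mono 16 311 18, Mono 6 305 24, Join 6 313 24 433 24,
     Mono 12 315 24, Join 8 316 17 258 22, Join 10 309 25 264 29, Join 2 318 24 322 28,
     Mono 28 308 17, Mono 6 320 17, Join 4 321 19 324 18],
    [Join 2 322 19 328 17, Join 6 323 20 368 17, Join 2 324 18 328 17, Join 8 380 17 321 22,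
     Mono 4 260 24, Mono 6 320 18, Join 6 337 21 324 21, Join 2 324 18 329 17, Mono 8 330 20,
     Mono 18 320 20, Mono 14 328 20, Join 6 333 20 345 20, Join 8 334 20 362 20,
     Join 4 438 25 316 25, Mono 12 336 18, Join 4 324 22 361 21, Join 12 338 19 340 18,
     Join 6 341 24 285 24, Join 12 342 18 344 17, Mono 12 336 17, Mono 4 329 20, Mono 20 352 17,
     Join 8 353 19 356 18, Join 4 354 19 356 18, Join 4 360 17 353 19, Join 8 360 18 354 18,
     Join 7 417 26 296 26, Mono 8 359 18, Join 5 297 24 417 24, Mono 4 352 18],
    [Mono 12 368 18, Join 6 312 26 369 26, Join 6 376 18 370 18, Mono 18 372 18, Mono 6 321 20,
     Mono 6 322 20, Mono 6 372 17, Join 8 332 17 322 19, Mono 18 384 18, Join 6 392 21 385 22,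
     Join 6 386 19 388 18, Join 6 432 17 387 20, Join 6 393 21 388 22, Join 8 386 28 266 28,
     Join 6 392 17 390 18, Mono 6 384 17, Join 6 385 19 396 17, Join 6 388 22 408 21,
     Mono 14 394 20, Mono 12 395 20, Mono 6 385 20, Join 12 397 20 425 20, Join 6 390 20 402 20,
     Mono 4 386 20, Mono 12 400 17, Join 12 401 19 404 18, Join 6 412 17 402 19,
     Join 6 405 18 408 17, Mono 12 400 18, Mono 6 393 20],
    [Mono 12 416 17, Join 12 418 19 420 18, Join 12 422 18 424 17, Mono 12 416 18,
     Mono 12 432 18, Join 6 434 18 440 18, Mono 12 436 17, Mono 6 392 20, Mono 6 384 20,
     Mono 24 448 17, Mono 12 449 20, Mono 12 450 20, Join 6 452 21 482 21, Mono 12 455 20,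
     Mono 8 456 17, Mono 19 457 20, Mono 12 456 18, Join 10 325 24 269 24, Join 5 261 28 489 20,
     Mono 8 262 24, Mono 28 256 20, Mono 12 464 17, Join 6 465 21 452 21, Join 6 468 17 466 17,
     Mono 12 472 17, Mono 12 472 18, Mono 12 480 17, Join 6 484 17 481 17, Mono 6 488 17,
     Mono 6 292 24],
    [Mono 5 299 24]]"
  by code_simp

text \<open>The triples abc, abd, cef, efg: two triples meeting in c, each with a partner on its
  other two elements. Exchanging the two ends preserves the weights.\<close>

lemma cert_dumbbell4: "cert_ok [135, 139, 180, 240] [3, 3, 4, 2, 3, 3, 2] [
    [Mono 14 128 20, Join 6 129 26 248 18, Mono 6 130 20, Join 4 131 20 176 17,
     Join 4 132 22 153 21, Join 6 133 24 209 20, Join 2 134 24 146 28, Mono 8 136 24,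
     Mono 10 137 20, Mono 10 138 20, Mono 6 139 17, Join 6 200 20 140 24, Join 2 141 24 201 20,
     Join 2 202 20 142 24, Mono 2 128 18, Join 6 144 28 192 20, Join 4 193 20 145 28,
     Join 4 156 17 146 19, Join 2 195 24 147 24, Join 2 148 24 192 20, Join 2 194 20 150 24,
     Mono 6 144 17, Join 4 152 24 200 24, Join 4 216 21 132 26, Join 4 154 28 206 20,
     Mono 2 144 18, Join 2 146 28 198 20, Join 2 157 24 201 20, Join 4 148 18 152 17,
     Join 2 145 19 156 17],
    [Mono 6 160 17, Join 2 172 17 161 19, Join 2 164 18 162 19, Join 2 195 24 163 24,
     Join 2 162 24 194 24, Join 2 165 18 168 17, Join 4 192 20 164 24, Mono 2 160 18,
     Join 2 166 18 168 17, Join 2 169 28 201 20, Join 2 206 20 170 28, Join 6 207 20 160 27,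
     Join 4 168 17 161 19, Join 2 132 21 161 21, Join 2 204 20 168 28, Join 2 175 24 207 20,
     Mono 4 176 18, Join 2 184 18 177 18, Join 2 184 18 178 18, Mono 4 131 24, Mono 8 180 18,
     Join 2 181 26 252 17, Join 6 248 18 130 26, Mono 6 180 17, Mono 4 136 20, Mono 4 128 24,
     Mono 4 192 17, Join 4 204 17 193 19, Join 2 204 17 194 19, Join 4 194 19 196 18],
    [Join 2 200 17 197 18, Join 4 162 28 198 20, Join 2 132 22 170 21, Join 2 152 28 204 20,
     Join 6 169 28 205 20, Join 4 202 17 196 18, Mono 10 208 17, Join 4 209 19 212 18,
     Join 4 220 17 210 19, Join 6 213 18 216 17, Mono 6 208 18, Join 2 130 22 140 21,
     Mono 10 224 17, Join 4 228 17 225 17, Join 6 234 20 142 24, Join 2 233 17 228 18,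
     Join 6 232 18 226 18, Mono 4 231 18, Mono 8 240 17, Join 2 145 24 193 24, Mono 8 244 17,
     Join 4 136 17 134 18, Mono 6 143 24, Mono 8 129 20]]"
  by code_simp

text \<open>The triples abc, abd, cef, egh, ghi: as for the shorter dumbbell, with cef as a link
  between abc and egh. Up to the common factor 79698317 the weights are 2, 2, 3, 1, 3, 2, 2, 2, 1;
  the scaling allows integral multipliers.\<close>

lemma cert_dumbbell5: "cert_ok [519, 523, 564, 720, 960] [159396634, 159396634, 239094951, 79698317, 239094951, 159396634, 159396634, 159396634, 79698317] [
    [Mono 36840790 512 33, Mono 3134020 513 40, Mono 159396634 514 36,
     Join 125279962 515 38 560 35, Mono 159396634 516 40, Mono 188424002 517 40,
     Mono 637586536 518 40, Mono 1397728916 512 40, Join 159396634 726 34 520 41,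
     Mono 317281830 521 48, Mono 453875512 522 40, Mono 353732944 523 36, Mono 314228868 524 40,
     Join 163961034 513 38 524 37, Mono 232329248 526 48, Mono 325446666 527 40,
     Join 159396634 528 45 611 41, Join 17836008 529 52 801 44, Join 95351144 774 44 530 52,
     Join 176454970 531 44 544 41, Join 127644844 532 48 644 56, Join 318793268 533 40 581 40,
     Join 159396634 534 48 902 40, Join 150159336 583 52 535 52, Join 228407650 808 44 536 52,
     Join 478189902 525 36 537 36, Join 150122768 538 33 532 34, Mono 14693454 528 34,
     Join 476100904 540 40 652 40, Join 1622582 520 53 533 54],
    [Join 104544904 542 48 590 56, Join 40281020 839 46 543 52, Join 263755432 544 44 704 36,
     Mono 154348632 545 40, Join 133661254 996 33 546 49, Mono 478189902 547 40,
     Join 214434470 704 36 548 40, Join 318793268 549 52 705 52, Join 104358798 706 52 550 52,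
     Join 157433788 1010 34 552 58, Mono 472002920 553 40, Join 422918280 526 44 554 44,
     Mono 159396634 555 33, Join 129096854 556 49 801 51, Mono 165583616 557 48,
     Join 159396634 558 52 714 52, Mono 159396634 555 48, Mono 671703208 515 40,
     Join 35581568 561 40 609 40, Join 159396634 562 40 610 40, Join 142338298 531 48 899 40,
     Mono 159396634 564 33, Mono 948681384 513 36, Mono 484843300 514 40, Mono 26738580 567 34,
     Join 158850112 875 40 568 50, Join 71862386 681 40 569 40, Join 135381008 570 48 938 40,
     Join 318793268 619 40 571 40, Mono 645284956 573 40],
    [Mono 318793268 522 36, Mono 32125984 575 40, Mono 965617102 576 36,
     Join 318793268 821 40 577 52, Join 86464020 580 34 578 35, Join 19782454 579 41 528 41,
     Join 208338744 580 52 528 52, Join 479812484 541 40 653 40, Join 159396634 582 36 610 36,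
     Mono 318085200 528 33, Join 35581568 625 35 584 37, Mono 497648492 585 36,
     Mono 403128518 586 36, Mono 226532846 587 36, Join 159396634 588 37 610 38,
     Join 159396634 797 40 589 56, Join 123420972 782 48 590 48, Mono 710519150 578 36,
     Mono 298547046 592 33, Join 299334678 584 37 593 38, Join 75061384 584 37 594 38,
     Join 159396634 624 35 579 38, Join 180663020 580 46 536 45, Join 178855224 597 52 769 44,
     Join 47378298 598 50 768 43, Join 29483520 596 33 594 33, Mono 285207924 600 33,
     Join 318793268 596 34 601 33, Join 214248364 594 35 604 33, Mono 159396634 600 34],
    [Mono 92260422 587 33, Join 19458590 593 35 596 34, Join 243731884 538 52 842 44,
     Join 200121610 607 48 768 43, Join 263070844 816 40 608 56, Join 123815066 609 35 620 33,
     Join 177291412 582 44 530 44, Join 20417738 931 43 528 54, Join 318793268 612 34 609 35,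
     Join 34505508 613 54 520 53, Join 159396634 806 48 614 48, Mono 35035046 615 34,
     Mono 546522 616 33, Join 546522 808 50 617 50, Join 60319624 794 44 618 52,
     Join 318246746 619 48 808 50, Join 35581568 812 48 620 48, Join 34505508 805 48 613 48,
     Join 284131864 796 40 588 56, Mono 533912326 608 33, Join 159396634 624 50 800 42,
     Mono 477832932 584 36, Join 159396634 632 34 626 34, Join 299010814 579 56 787 40,
     Mono 796983170 628 33, Mono 478189902 577 36, Join 391725882 630 48 770 44,
     Mono 150159336 576 33, Join 159396634 562 40 674 40, Join 16122978 633 52 777 44],
    [Join 24015626 570 48 618 56, Mono 478189902 560 34, Join 33585344 600 36 588 36,
     Join 139938044 829 40 585 52, Join 234458018 794 40 586 56, Join 87897050 795 41 591 56,
     Mono 1115776438 640 36, Join 1622582 644 33 641 33, Join 39697068 644 34 642 35,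
     Join 142338298 643 38 672 38, Join 318793268 644 37 657 37, Join 320415850 648 33 645 34,
     Mono 709236482 642 36, Mono 1622582 647 36, Join 149828774 644 38 648 37,
     Mono 637586536 649 36, Join 113818770 830 40 650 52, Mono 144703180 651 33,
     Join 43114654 540 48 908 40, Mono 795360588 641 36, Join 45577864 654 56 542 48,
     Mono 345419464 655 36, Mono 637586536 656 33, Join 358490336 790 40 646 56,
     Join 125280800 658 35 668 33, Join 93529010 660 48 772 40, Join 159396634 773 40 661 48,
     Join 34115834 774 40 662 48, Mono 103211108 663 34, Mono 478189902 664 33],
    [Join 159396634 777 40 665 48, Join 113818770 654 36 666 36, Mono 14693454 667 33,
     Mono 486135180 648 36, Join 161019216 669 48 781 40, Join 11462030 670 49 768 43,
     Join 129366592 671 48 779 41, Join 17058336 787 40 643 56, Join 20687378 801 48 673 48,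
     Join 159396634 684 33 674 35, Join 301734932 675 40 563 40, Join 246930882 676 34 681 33,
     Mono 318793268 672 33, Mono 210571642 680 33, Join 71862386 776 45 676 54,
     Join 318793268 682 52 778 44, Join 319339790 568 42 683 40, Join 159396634 770 44 674 52,
     Join 108221626 569 48 937 40, Join 57046618 827 40 680 58, Join 318793268 688 35 643 38,
     Join 49552426 801 40 689 48, Join 159396634 696 34 690 34, Join 301734932 803 40 691 48,
     Join 479812484 692 48 768 44, Join 317170686 693 50 776 45, Join 48049620 642 48 770 48,
     Mono 476567320 692 33, Join 87534248 552 42 689 42, Join 546522 699 49 779 44],
    [Join 167341912 776 44 700 48, Mono 523767766 650 36, Join 174090088 651 56 539 48,
     Join 159396634 707 36 544 41, Join 159396634 545 44 705 36, Mono 214434470 550 48,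
     Join 159396634 544 41 708 37, Join 159396634 713 33 708 34, Mono 318793268 704 33,
     Mono 288493488 712 33, Join 34116672 928 40 560 48, Mono 422918280 558 48,
     Join 30299780 714 33 716 33, Join 159396634 553 44 713 36, Join 129096854 716 36 552 44,
     Join 129096854 714 53 516 54, Mono 1238332282 720 33, Mono 157774052 525 40,
     Join 471536504 732 33 514 43, Mono 423152066 548 48, Join 3134020 968 37 516 54,
     Mono 449162534 517 48, Join 185132014 997 38 520 53, Mono 478189902 720 34,
     Join 151698214 757 34 728 37, Mono 159396634 521 40, Mono 294478878 730 36,
     Mono 10102210 519 48, Join 3134020 721 54 972 37, Join 318793268 524 45 738 38],
    [Mono 6653398 526 40, Join 183711024 522 33 516 34, Mono 423152066 736 33,
     Join 318793268 748 33 737 35, Join 214434470 738 33 740 33, Join 159396634 744 33 740 34,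
     Mono 484843300 722 36, Mono 318793268 736 34, Mono 159396634 744 33,
     Join 159396634 748 33 745 33, Join 373831104 706 36 546 44, Join 483237904 996 33 545 49,
     Join 25969166 754 50 1000 42, Mono 495248238 755 48, Mono 789284750 565 40,
     Join 192625008 636 48 776 44, Mono 461131566 727 36, Mono 422918280 552 40,
     Mono 65675404 761 48, Join 263521646 760 34 754 34, Mono 192205782 763 48,
     Join 238982646 764 33 758 34, Mono 748391308 520 40, Mono 17660992 527 48,
     Join 305242240 780 40 668 48, Mono 55654076 768 33, Mono 637586536 769 36,
     Mono 357207668 770 36, Join 301734932 992 37 771 44, Join 263139192 786 37 772 37],
    [Mono 318793268 773 40, Join 252925644 898 40 530 48, Mono 215050710 775 36,
     Join 168965412 981 34 776 41, Mono 618127946 777 36, Mono 478189902 778 36,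
     Join 16511814 827 40 683 56, Join 330159644 961 35 780 49, Join 157774052 1001 36 781 44,
     Mono 23362672 782 48, Mono 318793268 784 33, Join 320415850 673 52 785 44,
     Join 215050710 792 34 786 34, Join 159396634 787 36 800 37, Join 316608616 793 33 788 34,
     Mono 98770374 774 48, Join 316069150 784 38 771 38, Join 111455198 904 44 792 44,
     Join 2184652 836 40 788 40, Join 75404370 794 36 782 36, Mono 127153660 795 33,
     Join 151917772 796 40 652 56, Join 36612278 793 44 909 44, Join 163661966 772 38 794 37,
     Join 34427626 792 33 785 35, Join 138709256 687 48 800 51, Join 121161774 897 40 785 40,
     Mono 125046176 802 48, Mono 17058336 803 48, Join 125046176 804 50 994 35],
    [Mono 124891126 805 48, Mono 159396634 800 33, Join 187490210 536 48 904 40,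
     Mono 161019216 809 40, Mono 159396634 810 48, Mono 318793268 811 33, Mono 283211700 812 48,
     Mono 41562606 813 48, Mono 159396634 800 34, Mono 637040014 616 34,
     Join 177232642 824 34 817 34, Join 159396634 818 40 866 40, Join 19782454 771 40 595 48,
     Mono 38234860 769 40, Join 38414400 822 34 828 33, Join 193512468 660 33 658 33,
     Join 159396634 529 52 865 44, Join 369968276 824 40 680 56, Join 234458018 602 36 618 36,
     Join 6186982 553 36 525 36, Join 3335612 964 38 777 45, Join 276653002 772 38 792 37,
     Join 2184652 785 38 780 37, Mono 637586536 832 33, Join 139938044 833 35 836 34,
     Join 112018336 834 40 530 48, Join 103127688 880 33 835 36, Join 159396634 836 38 866 38,
     Mono 497648492 833 36, Join 107109566 850 36 838 36],
    [Mono 318793268 832 36, Join 386817112 834 34 840 34, Mono 478189902 841 36,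
     Join 52287068 840 33 838 34, Mono 546213746 843 33, Join 177746632 858 37 844 37,
     Mono 621275130 842 36, Mono 419645590 847 36, Mono 478189902 848 33,
     Join 159396634 849 37 836 37, Join 164305404 852 33 850 33, Join 375062214 864 37 851 36,
     Mono 138751088 834 36, Join 318793268 853 34 856 33, Mono 283853592 523 48,
     Mono 4908770 855 34, Join 139938044 617 36 601 36, Join 124735230 858 33 860 33,
     Mono 20246222 859 33, Join 34505508 844 37 865 38, Join 339039490 779 40 592 50,
     Mono 8529230 535 34, Mono 262524322 864 33, Join 106541128 872 36 844 36,
     Join 17273938 874 37 836 38, Join 124891126 865 33 868 33, Join 34505508 873 33 868 34,
     Join 159396634 870 50 552 49, Mono 89309558 871 34, Mono 371648774 872 33],
    [Join 177232642 825 40 617 56, Join 142122696 876 33 874 33, Join 125437648 569 48 873 40,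
     Join 1076060 588 37 617 37, Join 146125026 520 53 561 51, Mono 478736424 880 34,
     Join 249782252 613 50 808 49, Mono 437908882 839 36, Join 299334678 837 40 533 48,
     Mono 357878990 840 36, Mono 119115614 887 34, Join 175708040 846 36 858 36,
     Mono 956379804 896 33, Mono 478189902 897 36, Mono 432710512 898 36,
     Join 176454970 899 36 928 37, Join 267618260 936 37 900 38, Join 159396634 913 36 901 36,
     Mono 122784356 903 34, Mono 153073938 904 36, Mono 478189902 905 36, Mono 314184950 906 36,
     Mono 159396634 907 33, Join 79669702 906 37 908 37, Join 36612278 897 35 908 33,
     Join 159396634 908 36 936 36, Mono 674198814 903 36, Mono 294359532 912 33,
     Mono 420413870 801 40, Join 93529010 916 33 914 33],
    [Join 352909940 723 38 544 43, Join 318793268 930 36 914 36, Join 326738546 920 33 918 34,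
     Mono 27793138 912 34, Mono 291000130 920 34, Join 159396634 924 33 921 33,
     Join 24015626 938 36 922 36, Join 156037232 912 37 931 36, Join 60319624 922 33 924 33,
     Join 231046580 694 49 768 45, Join 178855224 885 34 892 33, Join 45577864 668 33 666 33,
     Mono 108221626 928 34, Join 159396634 929 37 900 37, Join 159396634 932 33 930 33,
     Join 180084012 615 48 800 49, Join 258473644 634 48 810 40, Join 180084012 940 33 929 35,
     Mono 318793268 928 33, Join 51175008 900 38 937 37, Mono 51175008 936 34,
     Join 318793268 938 33 940 33, Join 137086674 561 40 673 40, Mono 193513306 944 34,
     Join 210571642 952 34 945 34, Join 159396634 952 34 946 34, Mono 161019216 948 33,
     Join 1622582 956 33 897 38, Join 344963824 950 34 904 37, Mono 370727062 951 34],
    [Join 460353894 529 53 516 53, Join 84335250 906 40 538 48, Mono 637586536 960 33,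
     Mono 11366376 769 48, Join 60626260 962 37 964 37, Mono 95434762 964 40,
     Join 289765900 965 34 968 33, Join 306216628 988 33 962 43, Mono 169498844 967 40,
     Join 164368818 982 34 968 41, Mono 476678464 969 40, Mono 159396634 970 36,
     Mono 124456958 971 40, Mono 214668256 554 40, Mono 304467888 973 40, Mono 96605254 782 40,
     Join 20687378 993 37 516 53, Mono 159396634 976 33, Join 90336808 1020 33 769 46,
     Mono 205547346 978 36, Mono 249952550 774 40, Mono 29027368 725 48,
     Join 20921164 968 37 992 38, Mono 345531848 519 36, Mono 187490210 984 36,
     Mono 317281830 985 36, Join 200422290 536 33 532 34, Join 357710448 1013 34 764 49,
     Mono 197811034 776 36, Mono 479701340 521 36],
    [Join 60319624 974 36 810 44, Mono 215119058 816 34, Mono 3862828 544 48,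
     Join 9237298 628 50 779 44, Mono 353143726 804 48, Mono 289490812 546 40,
     Mono 756089728 728 36, Join 154348632 998 34 1000 33, Join 36313304 1016 34 802 42,
     Join 68569242 584 33 582 34, Mono 317170686 809 48, Mono 335851604 672 34,
     Join 162120752 784 41 580 57, Mono 8223606 753 48, Join 349093048 556 40 712 36,
     Mono 137790882 1008 34, Join 249697994 663 48 768 41, Mono 476227056 802 40,
     Mono 50564692 1012 33, Join 121161774 924 33 913 35, Join 79669702 910 40 798 40,
     Join 215665580 528 49 835 41, Mono 14861704 1016 34, Join 87534248 813 48 685 48]]"
  by code_simp

text \<open>The triples abc, abd, cef, egh, gij: a pair of triples followed by a tail of three. Up
  to the common factor 1176123910298436803 the weights are 8, 8, 12, 5, 12, 8, 9, 7, 4, 4.\<close>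

lemma cert_tadpole5: "cert_ok [1031, 1035, 1076, 1232, 1856] [9408991282387494424, 9408991282387494424, 14113486923581241636, 5880619551492184015, 14113486923581241636, 9408991282387494424, 10585115192685931227, 8232867372089057621, 4704495641193747212, 4704495641193747212] [
    [Mono 84808684534396906570 1024 36, Join 17224088218684145143 1244 37 1025 46,
     Join 27987918188016330868 1084 41 1026 46, Join 5880619551492184015 1888 37 1027 52,
     Join 3121282507250958523 1048 61 1028 62, Mono 29106876633873954165 1029 40,
     Join 3664643497142633316 1170 44 1030 44, Mono 16465734744178115242 1031 40,
     Mono 67515675358557651453 1032 36, Mono 38671516529964398149 1033 40,
     Mono 22290900835537436129 1034 48, Mono 41164336860445288105 1035 40,
     Mono 43527265893190216727 1036 48, Join 14871840398087271537 1037 52 1065 52,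
     Mono 31755345578057793681 1038 40, Mono 26923086943954589715 1039 40,
     Mono 8694790674385625862 1040 48, Join 383357230706911420 1041 49 1044 49,
     Join 14982261032879417186 1042 52 1094 52, Join 1618056712051919232 1155 43 1043 43,
     Join 2352247820596873606 1185 44 1041 44, Mono 15672968064586589859 1045 48,
     Mono 15289610833879678439 1046 48, Mono 10915224743275196866 1040 33,
     Join 3450829845730607423 1878 34 1048 49, Join 7063050464161815769 1833 52 1049 52,
     Join 6378568399644850373 1898 44 1050 60, Mono 12937363013282804833 1051 33,
     Mono 10009937719394525497 1028 48, Mono 3528371730895310409 1053 48],
    [Mono 3528371730895310409 1054 48, Join 5034605191783012851 1055 40 1099 41,
     Mono 14648799047291486373 1056 40, Join 15494287438811808515 1057 44 1217 36,
     Join 15846395194751398061 1064 49 1058 51, Mono 34107593398654667287 1059 40,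
     Mono 13600081238024078096 1060 48, Join 18613305959842858772 1061 40 1217 36,
     Mono 24698602116267172863 1062 48, Join 29188708851449712271 1223 36 1063 40,
     Join 5079360866093544091 2034 34 1064 58, Mono 201005132505670329 1065 48,
     Mono 5202444489346413570 1066 48, Mono 13348352283996210932 1067 48,
     Join 2723411064199986836 1096 60 1068 56, Join 17585008792312214062 1069 40 1225 36,
     Mono 14384551677509735464 1070 48, Join 10648361578825480231 1071 40 1216 38,
     Mono 5880619551492184015 1072 34, Mono 31532273272399862157 1073 48,
     Mono 5777227189319863986 1074 48, Join 13914607938746531999 1072 33 1027 36,
     Mono 8431746356923767258 1076 33, Mono 3528371730895310409 1025 36,
     Join 17920631857264275998 1078 50 1800 53, Mono 24698602116267172863 1076 48,
     Mono 6265753630232173690 1080 48, Join 3528371730895310409 1193 40 1081 40,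
     Join 4888097840207036488 1082 44 1098 44, Join 734191108544954374 1072 57 1155 52],
    [Join 8163352787761854117 1893 38 1032 53, Mono 10368349889399194654 1033 36,
     Mono 15249893290238106890 1026 40, Mono 34107593398654667287 1076 34,
     Mono 6987120407884459047 1088 33, Mono 39159140752809765888 1089 36,
     Join 8892091296691502686 1090 52 1570 52, Join 17899740871216683841 1136 33 1091 36,
     Join 9185918976729562900 1097 37 1092 38, Join 8529088495676023531 1093 40 1157 40,
     Join 3605129476022930027 1094 36 1106 36, Mono 46835037861632468147 1088 36,
     Join 15362471357581696248 1141 34 1096 37, Join 391036244505934825 1453 52 1097 60,
     Mono 31077170515912023236 1098 36, Mono 7386853012379886457 1047 34,
     Join 1005796190966467908 1100 56 1676 56, Join 19771034169415494127 1101 44 1049 44,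
     Join 3017280737625589454 1102 48 1550 48, Mono 6726633911201355179 1103 36,
     Mono 32500034224133808736 1104 34, Join 8080551028086810475 1116 33 1105 35,
     Join 4474687725358188945 1106 34 1112 34, Mono 4698160975945399099 1107 33,
     Join 12320259252700063291 1108 48 1300 48, Join 14265803267583488782 1108 33 1105 33,
     Join 17641858654476552045 1110 34 1112 33, Join 7034713527462988488 1093 44 1041 44,
     Join 767738647838776675 1110 48 1302 48, Join 5880619551492184015 1113 48 1561 48],
    [Join 9677132214704602515 1114 48 1562 48, Mono 7286551377626179085 1112 34,
     Join 9611746255393810376 1116 48 1564 48, Join 10892824078288967642 1130 37 1092 38,
     Join 23730437842621892235 1115 48 1296 50, Join 5702826344905165522 1106 35 1108 34,
     Mono 25749801302194766570 1120 34, Join 2872445080671490293 1585 56 1121 56,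
     Join 3176069995263622315 1122 35 1128 33, Join 12937363013282804833 1315 56 1123 56,
     Join 4485014770205531842 1572 48 1124 48, Join 4430304451934413632 1573 48 1125 48,
     Join 3528371730895310409 1096 37 1126 38, Mono 15289610833879678439 1120 33,
     Join 4921358585696943093 1040 46 1128 41, Join 11232315653927940223 1128 33 1121 35,
     Join 12010148476443736095 1698 56 1122 56, Join 22987166082258491323 1131 40 1072 42,
     Join 21612796722382812807 1224 52 1068 56, Join 16896169902133387665 1129 33 1124 34,
     Mono 5734637872738284982 1104 33, Join 6188328437095220430 1134 48 1582 48,
     Join 6110591215124387535 1040 54 1091 54, Join 3528371730895310409 1144 34 1137 34,
     Join 10566164055142605847 1144 34 1138 34, Join 255677707848202391 1139 48 1331 48,
     Mono 25616843809825477870 1140 33, Join 5195883000614866399 1580 52 1096 52,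
     Join 265745522094204441 1142 48 1538 52, Mono 15337574500314806262 1140 34],
    [Join 9531334782103139833 1138 48 1330 48, Join 14330252226867978209 1129 56 1081 56,
     Join 12604065226600102371 1146 48 1338 48, Join 1138777177057861037 1147 48 1331 50,
     Join 8273062460035354533 1148 56 1544 60, Join 9192225979100757851 1089 60 1329 60,
     Mono 8049265173075768345 1082 48, Join 11252801229854716561 1335 48 1088 53,
     Join 7905677278387779262 1152 52 1796 44, Join 15613438419320515113 1156 33 1153 33,
     Join 23898740741895245575 1212 33 1154 38, Mono 13465374118857716557 1155 36,
     Join 1176123910298436803 1812 40 1156 56, Mono 14141093385435112400 1157 48,
     Mono 10681669415291682585 1158 48, Join 10164620514979645370 1845 40 1153 52,
     Join 643976956868168841 1478 50 1160 49, Mono 31755345578057793681 1161 36,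
     Join 10682604525824716789 1838 40 1162 52, Mono 958646284405201366 1163 48,
     Join 15150933215152670523 1164 44 1048 44, Join 12937363013282804833 1817 44 1165 52,
     Join 3818525973786441112 1166 56 1806 40, Mono 23739955831861971497 1163 33,
     Mono 19994106475073425651 1168 33, Join 21170230385371862454 1172 34 1169 35,
     Mono 14621494516767210043 1030 48, Join 9850924084140976853 1171 36 1184 37,
     Join 3528371730895310409 1168 36 1156 36, Join 19994106475073425651 1173 34 1176 33],
    [Join 18857700108416560397 1174 48 1798 40, Join 12204860670231952190 1799 40 1168 49,
     Join 1293800568425125674 1176 37 1195 36, Join 7477238139496906675 1177 48 1801 40,
     Join 3528371730895310409 1066 44 1178 44, Join 15984632268554634769 1179 48 1803 40,
     Join 1093522308067959236 1180 52 1800 44, Join 3390116740173962843 1181 53 1792 46,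
     Join 19437257074826153851 1182 48 1806 40, Join 32795197722108907577 1183 48 1807 40,
     Join 10731535548355560357 1184 56 1840 40, Join 4331486369211071796 1121 40 1185 40,
     Mono 3751987812898938544 1186 48, Join 17641858654476552045 1843 40 1187 56,
     Mono 5880619551492184015 1188 48, Join 2676075406037710280 1189 49 1952 49,
     Mono 9740828469987793063 1190 48, Mono 10585115192685931227 1184 33,
     Join 21854406150104948081 2017 34 1192 50, Join 21170230385371862454 1193 33 1188 34,
     Mono 6398686518630918470 1194 48, Join 4068584916597920927 1851 40 1195 56,
     Mono 22708748625354672477 1196 48, Mono 17641858654476552045 1197 48,
     Join 6495140042284526381 1186 38 1164 37, Join 1176123910298436803 1071 40 1152 46,
     Mono 27050849936864046469 1200 34, Join 10585115192685931227 1201 48 1825 40,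
     Join 8232867372089057621 1794 44 1202 52, Mono 22515828383267016641 1043 48],
    [Mono 2352247820596873606 1204 34, Mono 19994106475073425651 1153 36,
     Mono 27293861910988701957 1154 36, Join 2205827464927244476 1120 56 1696 56,
     Mono 3372949329122478016 1208 34, Join 9625756585674230997 1145 48 1337 48,
     Join 2772825454596822499 1178 52 1834 44, Join 9371245538741350902 1211 48 1824 42,
     Join 4085221131142582209 1810 40 1154 56, Join 10585115192685931227 1853 40 1161 52,
     Mono 36836103755178050408 1160 36, Join 8988413648387545531 1178 37 1156 38,
     Mono 33523202799963520314 1216 33, Mono 6085296156424314091 1061 48,
     Join 15846395194751398061 1228 33 1218 35, Join 11677843319209079941 1219 48 1411 48,
     Join 14829972593934498232 1668 48 1220 48, Join 2205636124820296226 1221 48 1413 48,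
     Join 9658329139134272436 1156 49 1218 49, Mono 7828548370614732599 1063 48,
     Join 6081707758150886137 1672 48 1224 48, Join 3708044045994814737 1225 48 1673 48,
     Join 3261741612914721490 1228 33 1226 33, Join 2409736790531757933 1679 48 1227 49,
     Join 1265760457563677841 1224 33 1220 34, Join 7376753828218997763 1229 48 1677 48,
     Join 13227517256173935536 1230 48 1678 48, Join 8998002011674088325 1067 57 1231 52,
     Mono 24698602116267172863 1232 33, Mono 7194998452511968384 1233 48],
    [Mono 21130512841730290905 1234 36, Mono 13086190763142242875 1235 48,
     Mono 3528371730895310409 1028 40, Join 5880619551492184015 1301 56 1093 56,
     Join 2884092371462019095 1238 34 1032 41, Mono 5752856558582727261 1024 33,
     Mono 5880619551492184015 1240 48, Mono 17221363976770266188 1241 48,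
     Mono 5880619551492184015 1034 40, Mono 16465734744178115242 1243 33,
     Join 25467636802921257780 1100 40 1052 40, Join 19126858107355347247 1916 33 1025 54,
     Mono 531844550865145489 1246 48, Mono 25230446667132318352 1030 40,
     Join 7056743461790620818 1248 50 1699 50, Join 5205730813537148589 1249 34 1256 34,
     Join 4454593638286332839 1250 48 1442 48, Mono 83395783775288089 1251 34,
     Join 7800854469043990628 1257 33 1252 34, Join 5675942946560053939 1701 48 1253 48,
     Join 24141817755395453241 1058 60 1222 52, Mono 2566636726608081410 1248 33,
     Join 6305606286539805068 1256 48 1448 48, Join 933248075388468370 1257 48 1449 48,
     Join 4212714594958798995 1258 48 1450 48, Join 5880619551492184015 1841 40 1185 56,
     Join 3916516163852929999 1260 48 1708 48, Join 2352247820596873606 1261 48 1709 48,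
     Join 19084612682755577767 1070 56 1226 52, Join 20531801346982508398 1060 34 1066 33],
    [Mono 20529418598783670388 1264 34, Join 23991421556955511210 1441 48 1249 48,
     Mono 12937363013282804833 1058 40, Mono 2352247820596873606 1267 48,
     Mono 32860353496430977601 1076 40, Mono 2330217886269241276 1269 48,
     Mono 7056743461790620818 1026 48, Mono 4580897209702488714 1268 33,
     Mono 5880619551492184015 1064 40, Mono 21170230385371862454 1065 40,
     Mono 3049512371705280926 1274 48, Mono 14196882707356529725 1155 48,
     Join 7096868564452653299 1164 52 1832 44, Mono 15569533001701947946 1241 36,
     Mono 44509106392327309238 1086 40, Join 4702769944109936790 1060 50 1128 49,
     Mono 81152549810592139407 1280 33, Mono 55884049375358716926 1281 36,
     Mono 3528371730895310409 1282 40, Join 34325924373262293912 1283 36 1312 37,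
     Join 1997894073753624137 1474 37 1284 45, Mono 34107593398654667287 1285 40,
     Join 767738647838776675 1298 36 1286 36, Mono 8682222434650216330 1287 36,
     Join 7527235526596784980 1349 42 1288 41, Join 2447351235742859098 1289 45 1492 38,
     Mono 15289610833879678439 1290 40, Mono 23069710043499430395 1291 40,
     Mono 50240244824991255648 1292 40, Join 1128918468681944879 1293 44 1369 44],
    [Join 7616151601338299530 1514 36 1294 44, Mono 3528371730895310409 1295 36,
     Join 1128918468681944879 1348 41 1296 41, Join 8849971132671799163 1297 44 1413 44,
     Join 1584509172758096931 1286 48 1094 48, Join 13155693987890431458 1299 40 1347 40,
     Join 1734067953520844801 1108 48 1556 48, Mono 14409708047168207546 1029 48,
     Join 2242582733442337054 1302 34 1304 33, Mono 12937363013282804833 1296 33,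
     Join 27729759176907641819 1284 38 1304 37, Join 12937363013282804833 1305 44 1449 44,
     Join 4915449928160804265 1358 44 1306 44, Join 3528371730895310409 1359 44 1307 44,
     Join 11191994950095309232 1384 44 1304 44, Join 1735144060014132064 1421 40 1309 40,
     Join 845280533003479661 1292 45 1298 46, Join 3638036818049846961 1302 50 1048 49,
     Mono 9190660307779867799 1283 40, Mono 27762669122760790052 1313 40,
     Mono 33774295611971964825 1314 40, Join 17558462870701263956 1475 36 1312 41,
     Join 33142423775323287537 1316 40 1472 36, Join 237181472213741136 1317 54 1032 53,
     Join 12169624365444028158 1318 42 1288 45, Mono 5042326377574306260 1312 33,
     Join 12652749261162292746 1480 36 1320 44, Join 4947371476103715645 1321 44 1481 36,
     Join 17430904367509494992 1322 36 1306 36, Join 7169638049133602325 1371 44 1323 41],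
    [Join 4335058094674444404 1324 40 1416 44, Join 6908583052194654426 1325 40 1481 36,
     Join 3119986468435650281 1474 36 1318 40, Join 1032623195653302375 1327 40 1352 45,
     Join 8232867372089057621 1443 42 1328 42, Join 2221961410922258790 1589 48 1089 52,
     Join 1411937992344958064 1144 48 1336 48, Join 5771908744007788310 1595 48 1147 48,
     Mono 5880619551492184015 1332 40, Mono 42946686362075912093 1333 40,
     Join 9408991282387494424 1298 44 1414 44, Mono 41164336860445288105 1315 40,
     Mono 20934416303325341193 1336 34, Join 6097384854778920588 1329 42 1320 42,
     Join 8355210871804703030 1338 40 1450 40, Join 7776517806542980330 1339 41 1408 46,
     Mono 5880619551492184015 1288 36, Mono 24698602116267172863 1289 36,
     Mono 26014479409469551105 1342 40, Join 3528371730895310409 1308 44 1416 44,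
     Mono 15289610833879678439 1344 36, Mono 39166932031292589431 1345 36,
     Join 3739326017862367462 1356 37 1346 38, Mono 9190660307779867799 1347 36,
     Join 9408991282387494424 1361 38 1348 38, Join 5410127486686019853 1349 40 1413 40,
     Mono 12169624365444028158 1282 36, Mono 13386718075843963542 1351 34,
     Join 499585614253814138 1352 44 1320 44, Mono 29403097757460920075 1353 36],
    [Mono 29403097757460920075 1354 36, Mono 10585115192685931227 1355 33,
     Join 14257375628058359515 1356 40 1420 40, Join 3268632154597120969 1357 36 1385 36,
     Mono 14324441210548298689 1322 40, Mono 25425370964004450957 1351 36,
     Mono 31755345578057793681 1360 33, Join 4751701082810239136 1369 37 1348 38,
     Join 119889090327900089 1372 33 1362 35, Mono 2352247820596873606 1363 33,
     Join 12378342863567109572 1300 40 1412 40, Join 3528371730895310409 1372 33 1361 35,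
     Mono 14959501283290412800 1099 33, Join 7056743461790620818 1363 36 1376 37,
     Join 19994106475073425651 1368 34 1362 34, Join 4704495641193747212 1305 48 1113 48,
     Join 16977549452277318579 1370 33 1364 34, Mono 18913047614085163516 1371 33,
     Join 1387078197265493856 1378 36 1362 36, Join 7432132111450799488 1357 40 1309 40,
     Mono 22960816249130680515 1346 36, Mono 5767724964149202508 1323 40,
     Join 6583977534577723234 1376 40 1440 40, Join 14467941925193433117 1377 35 1388 33,
     Join 7056743461790620818 1388 33 1378 35, Join 16465734744178115242 1379 42 1328 42,
     Join 13902532636614184583 1378 35 1380 34, Join 5880619551492184015 1377 38 1348 38,
     Join 8021913085122000568 1382 40 1410 44, Mono 24698602116267172863 1376 33],
    [Join 2337265275689762279 1292 44 1384 44, Join 16977244910196300386 1525 34 1288 45,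
     Join 10585115192685931227 1348 38 1386 37, Mono 8232867372089057621 1376 34,
     Mono 41515044530316286597 1352 36, Join 2726475746269646715 1385 44 1421 44,
     Join 8563710749384014763 1106 48 1298 48, Join 1883304469610098456 1441 40 1377 40,
     Mono 12937363013282804833 1392 34, Join 3311606427608573836 1400 34 1393 34,
     Join 5037793427876449674 1400 34 1394 34, Mono 1434006127038568599 1395 34,
     Mono 44692708591340598514 1344 33, Join 5059338632637922144 1397 34 1352 37,
     Join 9759698952258492916 1142 48 1282 52, Join 10515492138779769456 1559 56 1095 56,
     Join 25257622265982868124 1308 33 1297 35, Join 4704495641193747212 1385 44 1305 44,
     Join 845280533003479661 1098 52 1310 52, Join 2354452329488803011 1139 50 1328 50,
     Join 18011296200995854853 1324 48 1132 48, Join 94715425314002041 1389 40 1417 44,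
     Join 14464194593452240128 1404 33 1346 38, Join 11881128193312268119 1116 48 1308 48,
     Mono 2131712337097317576 1328 34, Mono 45868832501639035317 1409 36,
     Mono 23344684999381717567 1410 36, Join 244149978811952340 1327 40 1411 46,
     Join 10870657343913467253 1412 37 1426 37, Join 1176123910298436803 1441 36 1413 36],
    [Join 6058412758079202508 1442 36 1414 36, Mono 10443461745935513080 1408 33,
     Join 10209726543025752557 1117 48 1309 48, Mono 22103478460760330824 1417 36,
     Mono 34107593398654667287 1418 36, Mono 15289610833879678439 1419 36,
     Join 6771201310563084792 1426 38 1420 37, Join 1418999745208405236 1421 36 1449 36,
     Join 7567834455060341773 1102 56 1422 56, Mono 9267337835637076277 1415 34,
     Mono 36459841219251540893 1424 33, Join 1176123910298436803 1425 44 1313 44,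
     Join 2721685367116176414 1450 37 1412 38, Join 12217588668530445321 1427 36 1440 37,
     Join 20611210235656167193 1428 34 1433 33, Join 12258453773239209483 1284 38 1288 37,
     Join 3670025177645728556 1420 33 1410 35, Mono 8791887521804752882 1431 34,
     Mono 273477998488159235 1432 33, Join 4192680933094543875 1370 44 1294 44,
     Join 3897809277414613217 1434 44 1294 44, Mono 1793227670881178345 1435 33,
     Join 1664986675507841779 1260 33 1249 35, Mono 21217435826988354378 1293 40,
     Join 2801602883158032315 1359 40 1311 40, Join 14730590684163983178 1432 34 1425 34,
     Mono 27067266298530866762 1440 33, Join 21991740724413425289 2040 34 1057 58,
     Join 10215677646166628419 1452 33 1442 35, Mono 46466835513935530755 1408 36],
    [Join 11319692760144669342 1444 49 1248 49, Join 21085593805426757563 1092 56 1044 56,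
     Join 2174454614009855113 1094 56 1414 56, Join 5407853624279286431 1120 48 1312 48,
     Mono 7900192235289889108 1448 33, Join 10835017195593345600 1250 34 1256 34,
     Join 8754011584640655590 1216 49 1412 49, Mono 3528371730895310409 1448 34,
     Join 8137763956943072129 1149 48 1289 52, Mono 29235133818612916774 1097 36,
     Join 10150674331529857014 1260 33 1258 33, Mono 13395325717789323814 1447 34,
     Mono 17641858654476552045 1456 34, Join 1735144060014132064 1412 37 1425 37,
     Join 4582152141478101803 1464 34 1458 34, Mono 456349565546077291 1459 34,
     Mono 35881720321249599528 1460 33, Join 17641858654476552045 1468 33 1461 34,
     Join 5073933187713050020 1468 33 1410 38, Mono 12484030071471735243 1463 34,
     Mono 1298467410014082212 1464 34, Join 6322165894331882703 1444 33 1442 33,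
     Join 965169623331379750 1124 48 1316 48, Join 1982810274077570798 1422 36 1434 36,
     Join 15052429361665937303 1317 34 1320 33, Mono 1285890999950519454 1472 33,
     Join 22962213933535899267 1476 33 1473 33, Join 7933097554070626337 1514 37 1284 46,
     Join 2133916845989246981 1299 48 1107 48, Join 1736388182731273596 1473 35 1484 33],
    [Join 12471814166163970081 1477 34 1480 33, Join 9742289069070196886 1474 36 1314 44,
     Mono 1901750637816119464 1479 34, Join 9838432505007701559 1480 33 1474 35,
     Join 1081408484984434762 1481 33 1476 34, Join 14577791647982934856 1477 36 1313 44,
     Mono 5880619551492184015 1472 34, Join 8971559754271228503 1484 36 1320 44,
     Join 3207650354276170705 1472 50 1160 50, Join 7299619296700589251 1521 34 1320 42,
     Join 7077799421951167825 1482 33 1484 33, Mono 11037883355155236892 1488 34,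
     Mono 3528371730895310409 1281 40, Join 14521872186040901764 1298 44 1350 44,
     Mono 87759938209821601516 1287 40, Mono 3006371385458554359 1284 40,
     Join 2001540150725875114 1342 48 1098 52, Mono 31755345578057793681 1286 40,
     Join 2806885124085051864 1107 48 1555 48, Mono 4234003576387583050 1288 40,
     Mono 15289610833879678439 1289 40, Mono 35283717308953104090 1290 36,
     Mono 4251727478724441547 1488 36, Join 2922146139563123224 1500 37 1281 46,
     Join 16373423145929662702 1384 40 1448 40, Mono 6639712483822842635 1294 40,
     Join 7762375307282893459 1493 38 1496 37, Mono 31282579650844896097 1504 33,
     Join 21873588368457401673 1516 33 1505 35, Join 20077502258848713740 1512 34 1506 34],
    [Mono 4621099857418459123 1507 34, Join 2860348146906402853 1514 33 1508 34,
     Join 2113194561913027607 1509 50 1192 49, Join 15697996096339338567 1482 36 1326 40,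
     Join 9881757209600392008 1508 33 1505 33, Join 28191639448065851609 1512 33 1508 34,
     Join 834532959026103839 1711 48 1259 49, Join 3611767514670598498 1219 38 1056 43,
     Join 11204454742112648408 1446 48 1254 48, Mono 3055605803682412825 1520 34,
     Join 36876872197219319076 1500 33 1282 43, Join 1083812312049984263 1522 34 1528 34,
     Join 4922826615801373837 1315 42 1328 42, Mono 11519425227482119418 1524 33,
     Join 10344129004251681305 1522 35 1288 45, Join 11909399512580334422 1325 40 1417 44,
     Mono 7856604836162548106 1162 36, Join 8685635534558363286 1151 48 1291 52,
     Mono 26807974101954078036 1321 40, Mono 28159568894134790149 1536 40,
     Mono 15159324424205063623 1537 36, Mono 42585806241919241422 1538 36,
     Mono 43516584681042161711 1539 40, Join 3528371730895310409 1540 45 1729 37,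
     Mono 34107593398654667287 1541 40, Join 6811397990615104304 1554 36 1542 36,
     Mono 52992980916457349258 1536 33, Join 7808632965505802652 1750 34 1544 41,
     Mono 21498256009556760556 1545 36, Mono 24698602116267172863 1546 36],
    [Mono 31755345578057793681 1547 33, Mono 22931835484197535472 1548 40,
     Join 3200346106710412307 1549 36 1561 36, Join 15954643750908394287 1538 35 1548 33,
     Mono 13307748487501288196 1551 40, Join 10380438587753801151 1679 40 1552 43,
     Join 841160895691691911 1553 34 1560 34, Join 6728717837605722716 1560 33 1554 35,
     Join 12482725709794626575 1667 40 1555 40, Join 4994649884084877915 1556 40 1668 40,
     Join 10789791797618061303 1557 40 1669 40, Mono 27296195408039562983 1542 40,
     Mono 23452855152062574289 1552 33, Join 3642805245339152489 1704 44 1560 44,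
     Join 2490549488028009579 1549 44 1625 44, Join 4108329084691741019 1706 44 1562 44,
     Join 33266432502962975376 1540 37 1553 37, Join 1766766632069637391 1676 40 1564 40,
     Join 4369532626587002320 1563 44 1632 43, Join 15289610833879678439 1556 34 1562 33,
     Join 2680273444781771708 1556 34 1561 33, Join 10428739934031786307 1735 36 1568 41,
     Mono 41544906247003101530 1569 40, Join 2968103967040853045 1730 36 1570 44,
     Join 10141441370594790630 1571 42 1648 42, Join 18881088177109059298 1578 33 1572 34,
     Join 10859306381945264807 1573 50 1064 49, Join 15289610833879678439 1574 40 1730 36,
     Mono 3528371730895310409 1568 33, Join 204676604932130076 1649 42 1576 42],
    [Mono 8167818640673730807 1577 40, Mono 12874257400948734383 1578 40,
     Join 3938759130234712050 1131 48 1579 48, Join 1971678434039060181 1580 33 1569 35,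
     Join 15178792861016372677 1736 36 1580 40, Join 2433346450880756377 1582 40 1674 44,
     Join 10741490451340076147 1728 36 1572 40, Mono 21061519577887466749 1584 34,
     Join 3212851075752823798 1585 40 1633 40, Join 6042681324574242166 1634 40 1586 40,
     Join 1790277915017300152 1587 41 1664 45, Mono 5880619551492184015 1588 34,
     Mono 47175242821612086936 1537 40, Mono 36459841219251540893 1590 40,
     Mono 1511086924905181695 1591 34, Join 7566779434820327179 1147 48 1592 50,
     Join 3528371730895310409 1593 40 1705 40, Join 5880619551492184015 1594 40 1642 40,
     Join 7106794696765892413 1027 54 1584 51, Mono 5880619551492184015 1544 36,
     Mono 29075072133276021973 1545 40, Mono 25874726026565609666 1546 40,
     Mono 37930612572360210181 1551 36, Mono 44692708591340598514 1600 33,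
     Mono 41164336860445288105 1601 36, Join 7117972498281284600 1660 33 1602 38,
     Mono 14183109977487403407 1603 36, Join 25195764267787559777 1604 37 1634 37,
     Join 12937363013282804833 1605 40 1557 40, Join 12692017542107288319 1558 40 1606 40],
    [Mono 15289610833879678439 1600 36, Mono 25629380555390093152 1608 36,
     Mono 29403097757460920075 1609 36, Mono 27897603878354711399 1610 36,
     Mono 10585115192685931227 1611 36, Join 266379419719883384 1640 36 1612 36,
     Join 1176123910298436803 1625 36 1613 36, Join 6148760483809292106 1614 36 1626 36,
     Mono 16136364775370343369 1607 34, Mono 23592101259874897831 1616 33,
     Join 12937363013282804833 1624 34 1617 34, Join 2597593291772390120 1618 46 1540 46,
     Join 5089509890775763699 1619 36 1632 37, Join 10316527115580180438 1620 34 1625 33,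
     Join 13067649422957419649 1621 38 1608 37, Join 245345471175516514 1608 37 1606 38,
     Join 4253705614460903734 1135 40 1159 46, Mono 7056743461790620818 1624 33,
     Join 1496134276726813748 1549 44 1673 44, Join 12165143126590380641 1798 52 1042 52,
     Mono 7593472471213479698 1627 33, Join 19523210569750001608 1560 44 1612 44,
     Join 6010905961166798831 1641 36 1625 36, Join 204516485603540659 1602 38 1612 37,
     Join 5054087431164025228 1552 44 1604 44, Join 11426276088377623138 1561 44 1641 44,
     Join 6852066856858490742 1633 34 1640 34, Join 901932721039103223 1093 36 1121 36,
     Join 1740226680042028557 1635 41 1552 45, Join 12281436363058984717 1636 33 1633 33],
    [Join 10831121263501214334 1637 34 1640 33, Join 10562319731544339650 1554 56 1090 56,
     Join 7670897466509484167 1639 40 1667 44, Join 12417165753208188146 1121 56 1697 56,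
     Join 5140941420429351958 1636 40 1664 44, Join 4704495641193747212 1642 36 1626 36,
     Mono 2557958615004145171 1643 33, Join 6638386330633186586 1644 41 1664 46,
     Mono 16883505179970522144 1037 40, Join 12297968112407226910 1115 48 1552 50,
     Join 15419897243554293255 1109 48 1557 48, Mono 5723235714425517224 1571 40,
     Join 7333799898916654855 1713 42 1576 42, Join 9246929509305436273 1080 50 1586 50,
     Mono 2795921642688014203 1648 34, Mono 22675724264478071130 1607 36,
     Join 9278704872712879608 1653 34 1608 37, Mono 33841847876560462846 1602 36,
     Join 20902089453054754363 1628 33 1618 35, Join 14779574860849972078 1592 56 1128 56,
     Join 1852565139068992333 1645 40 1673 44, Join 6894681688708562667 1594 56 1130 56,
     Mono 31705294343082522086 1632 33, Mono 25914921114511906578 1096 36,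
     Join 12204071922347911320 1224 33 1221 34, Join 5758276051776538606 1330 44 1410 44,
     Mono 14218532437099141878 1655 34, Join 1558850125819357066 1664 46 1564 45,
     Join 14113486923581241636 1665 38 1672 37, Join 10437927557688685478 1672 33 1666 35],
    [Join 6897226760559935727 1667 38 1712 35, Join 11181281749187937420 1706 37 1668 38,
     Join 6852066856858490742 1697 36 1669 36, Join 10294960949794800524 1670 36 1682 36,
     Mono 1176123910298436803 1664 33, Join 1564268343256056393 1672 37 1697 38,
     Mono 22551030900602429333 1665 36, Mono 32703183223075101964 1674 36,
     Mono 15289610833879678439 1675 33, Join 4499819036261617136 1689 37 1676 37,
     Mono 15159324424205063623 1549 40, Join 7346897704681751521 1672 37 1670 38,
     Join 8461153637370186141 1724 33 1666 38, Mono 22056200052779168554 1680 33,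
     Join 17641858654476552045 1692 33 1681 35, Join 7346897704681751521 1684 33 1682 33,
     Join 1505493879106208676 1604 34 1610 33, Join 5880619551492184015 1684 34 1690 33,
     Join 204676604932130076 1688 33 1685 34, Join 7056743461790620818 1686 34 1688 33,
     Join 1477239945764539047 1568 44 1680 44, Mono 10961792574971541 1688 34,
     Join 17426220256969450428 1688 36 1676 36, Join 4536684898018261918 1262 48 1710 48,
     Mono 12926401220707833292 1680 34, Mono 48382235364216391600 1664 36,
     Join 1380800515230566879 1577 44 1689 44, Join 9408991282387494424 1566 44 1674 44,
     Join 1788145050853281852 1587 40 1635 40, Mono 3528371730895310409 1696 34],
    [Join 1964103387639254016 1708 33 1697 35, Join 5035543621530809757 1668 38 1698 38,
     Join 13164520450111295717 1248 51 1704 49, Join 13325507446240424423 1705 33 1700 34,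
     Join 4253245595902057172 1249 48 1697 48, Join 3859419711232372954 1702 34 1704 33,
     Mono 19994106475073425651 1696 33, Join 8833925031246865009 1571 42 1696 42,
     Mono 13381287676071034970 1672 36, Join 8602869064768996790 1218 33 1220 33,
     Mono 31810799038190656809 1034 36, Join 7419137791474994038 1068 40 1160 44,
     Mono 31118917114596940193 1090 36, Join 13787785020028392900 1582 40 1738 36,
     Mono 1118634940363552476 1227 33, Mono 12221871839681155365 1712 34,
     Join 637608083074856620 1736 36 1576 44, Join 8829033928591063814 1714 34 1720 34,
     Mono 8998603883048092783 1579 33, Mono 37797120171530460373 1716 33,
     Mono 41164336860445288105 1673 36, Mono 19108136807666119551 1666 36,
     Mono 882641648790741222 1719 34, Join 694390868240272690 1720 34 1713 34,
     Join 10005157838889500617 1698 44 1554 44, Join 7696054016835305353 1737 36 1581 40,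
     Join 5590465308601053312 1730 41 1540 41, Join 850422006745588067 1736 33 1730 35,
     Join 5880619551492184015 1731 36 1568 41, Join 30119583427814176671 1737 33 1732 34],
    [Join 21170230385371862454 1729 34 1736 34, Join 2062093577705742903 1734 42 1544 41,
     Mono 7366639988466841752 1568 40, Mono 15289610833879678439 1576 40,
     Join 14561759660316533823 1583 40 1743 36, Mono 7942713129197926918 1540 40,
     Mono 15289610833879678439 1739 33, Join 4534167921861778317 1740 36 1576 44,
     Join 22206726422153495995 1741 36 1577 44, Mono 32775094229702085564 1728 33,
     Mono 11617231123364849773 1639 34, Mono 68282591750337027697 1543 40,
     Join 2277857625339358346 1745 35 1548 41, Mono 3528371730895310409 1538 40,
     Join 11306601799496189772 1683 36 1696 37, Join 1805734367715414180 1599 56 1091 62,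
     Join 26079402631497739742 1749 34 1544 41, Mono 18482628484247524203 1544 40,
     Mono 23299728916105298480 1751 36, Join 424234406583254969 1750 50 1240 49,
     Mono 13785461299396343534 1753 36, Mono 10585115192685931227 1754 36,
     Mono 34107593398654667287 1744 34, Mono 35283717308953104090 1550 40,
     Mono 41369013465377418181 1745 36, Join 4905013336819636877 1164 44 1096 44,
     Join 22011000215142834612 1782 34 1752 37, Mono 23064699459904017631 1760 33,
     Join 16670411349110245318 1761 35 1764 34, Join 20858871994976773155 1768 34 1762 34],
    [Join 10010048941545301812 1560 45 1699 43, Join 5880619551492184015 1768 33 1761 35,
     Mono 5430656997253680589 1400 34, Join 7861614498914044147 1638 40 1666 44,
     Mono 3839730121290399708 1760 34, Join 1920234917551806613 1120 43 1156 46,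
     Mono 31136637670572260855 1056 33, Join 14978252443484589140 1772 33 1770 33,
     Join 162061773082058151 1650 42 1576 42, Mono 3838268257571531343 1776 34,
     Join 22411403027085626071 1777 34 1576 42, Join 15352716446213748889 1778 50 1064 58,
     Mono 13440847991971846127 1704 33, Mono 9341586329359801301 1744 36,
     Mono 31656389417309805980 1570 40, Join 11453530217381331615 1638 34 1640 33,
     Mono 18600507581652109739 1783 34, Join 4921260944480483785 1049 36 1065 36,
     Join 2929664763573194387 1104 38 1100 37, Join 3666626721616657975 1181 52 1801 44,
     Mono 32510974810649944627 1793 36, Join 6324241118739768175 1794 33 1796 33,
     Join 29047260052836213124 1824 37 1795 36, Join 12799108022561457267 1809 38 1796 38,
     Join 3528371730895310409 1873 44 1797 44, Mono 13426853382209001988 1794 36,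
     Mono 10141493625438347067 1168 34, Join 1312371131805861814 2002 34 1800 42,
     Mono 44692708591340598514 1801 36, Mono 41164336860445288105 1802 36],
    [Mono 6361722027115664488 1803 33, Join 17641858654476552045 1804 33 1794 35,
     Mono 12937363013282804833 1805 40, Mono 7323438619146761915 1806 40,
     Join 14672236592008875059 1800 33 1793 35, Mono 11771071597097042637 1808 34,
     Join 4767946607898715293 1823 40 1152 59, Join 7842864277433766935 1810 33 1812 33,
     Join 6445336572440421005 1811 40 1155 56, Join 8919500913461297269 1810 36 1826 36,
     Join 10446860201964583661 1813 50 1880 33, Join 15343229306471971913 1816 33 1814 34,
     Mono 14503490018236532322 1808 33, Join 2298629348004580132 1816 36 1832 36,
     Join 2352247820596873606 1821 40 1165 56, Join 12937363013282804833 1818 37 1796 38,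
     Mono 5890452045604858622 1819 33, Join 17641858654476552045 1820 33 1809 35,
     Join 14113486923581241636 1816 36 1804 36, Join 3448175981144517851 1176 37 1156 38,
     Join 13367932033589696327 1152 52 1824 44, Mono 1139138338262395782 1824 33,
     Join 4898587536945537485 1825 34 1832 34, Join 9778428828906797232 1900 33 1826 51,
     Mono 5060333345818454163 1795 40, Join 6780404054425667307 1828 34 1832 33,
     Join 11798224675020409051 1828 33 1825 33, Mono 1198687399566545588 1830 48,
     Join 11916661504757200423 1208 48 1832 40, Join 6119973386821096505 1828 34 1833 33],
    [Join 6825665994002789524 1064 50 1825 50, Mono 10193114156898519634 1834 40,
     Mono 7194591729760758213 1833 40, Join 4308103411421899354 1836 40 1992 36,
     Join 8412539687188561949 1837 40 1993 36, Join 3528371730895310409 1838 40 1994 36,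
     Mono 8426959267840847894 1835 33, Mono 24110248958844061304 1184 48,
     Mono 15076190506206208063 1185 48, Join 14800120464953481284 1842 34 1848 34,
     Join 11867980537850422850 1843 40 1955 40, Mono 22507172775659755608 1844 34,
     Mono 3490890822519414096 1176 34, Join 3851015794229526450 1884 33 1810 51,
     Mono 41753180260527379133 1844 33, Join 18951137543325380 1906 34 1848 50,
     Mono 1182430912669631754 1849 48, Join 18299915597636254393 1850 40 1194 56,
     Join 7299755435915276306 1206 48 1794 44, Mono 20301625384147666419 1800 36,
     Mono 1176123910298436803 1161 48, Mono 21449003588159586407 1026 36,
     Join 4681932151925638427 1830 38 1800 37, Mono 50573328142832782529 1856 33,
     Join 21010583878187948575 2012 37 1857 46, Join 38812089039848414499 1864 34 1858 34,
     Mono 12937363013282804833 1859 40, Join 26212713364068075968 1186 41 1028 45,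
     Join 17938079778063517955 2017 36 1861 44, Mono 19734375420420617383 1862 40],
    [Mono 35283717308953104090 1863 40, Join 24977375319054896816 1854 40 1162 52,
     Mono 10942453005856684150 1033 48, Mono 43050588416122217842 1866 36,
     Mono 7588588012655766307 1867 33, Mono 54112381085876147954 1868 40,
     Mono 16625381251362029121 1869 40, Mono 14246675289744811995 1870 40,
     Mono 6744760677757656857 1867 36, Mono 31041144970055925119 1872 33,
     Join 21170230385371862454 1797 44 1041 60, Join 12092082480279325172 1876 33 1874 33,
     Mono 19795227490238716014 1075 48, Join 2352247820596873606 1876 34 1881 33,
     Join 9922634922769020660 1877 34 1048 49, Mono 6632509055207365849 1240 36,
     Join 4597754206327692392 1923 43 1040 59, Join 138254990721347566 1880 36 1064 52,
     Mono 6270622646147474701 1812 48, Mono 11194377519905453410 1050 48,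
     Mono 8977556018165072676 1883 33, Mono 12990981485875098307 1822 48,
     Join 19994106475073425651 1813 40 1157 56, Join 12638642362520998304 1882 33 1044 50,
     Join 14227698388019766567 1852 40 1160 52, Join 5773878116626129195 2003 36 1888 41,
     Join 12937363013282804833 1889 33 1892 33, Join 4681932151925638427 1060 50 1890 35,
     Mono 26023553776425047708 1027 40, Mono 8255430861357166406 1890 40],
    [Mono 43056128901436630994 1084 48, Join 15289610833879678439 1894 40 1986 36,
     Mono 13341682014757129855 1888 33, Mono 19994106475073425651 1896 40,
     Join 1377129042804107132 1897 44 1997 36, Join 4801984974332532774 1930 40 1050 56,
     Join 15409663656286572786 1836 33 1826 35, Join 5742364560770836449 1793 40 1041 56,
     Mono 1513954646678995851 1319 34, Join 3300459006647706657 1902 40 1930 44,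
     Join 2826696306366407349 1071 56 1931 44, Mono 3528371730895310409 1904 34,
     Join 16242662438520183718 1905 34 1080 50, Join 2352247820596873606 1074 60 1922 44,
     Mono 1889668681106111835 1843 48, Join 7498043391613738012 2025 37 1860 46,
     Mono 41294623270119902921 1857 36, Mono 1529613840687072486 1910 40,
     Join 27094847821007304811 1827 52 1040 53, Join 6833671156132689294 1057 60 1041 60,
     Mono 416920758790578301 1848 48, Mono 13967066567911612506 1840 34,
     Mono 27748114487972453789 1066 40, Mono 30549861570250057815 1025 48,
     Join 564717020948236990 1043 58 1792 42, Mono 18584246010128778275 1866 40,
     Join 19462261924208280162 1866 33 1028 50, Mono 55277823784026529741 1920 36,
     Join 10585115192685931227 1924 33 1921 33, Mono 32971187031997802033 1922 36],
    [Join 13044104448148859653 1923 38 1952 38, Mono 25874726026565609666 1921 36,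
     Join 18817982564774988848 1928 33 1925 34, Join 5977173774097935373 1926 34 1928 33,
     Mono 6470918753757160461 1899 40, Mono 17262574914104573650 1928 36,
     Mono 24698602116267172863 1929 36, Mono 16596158135286933432 1930 36,
     Mono 3053923245125776666 1931 33, Join 15289610833879678439 1048 60 1932 44,
     Join 9408991282387494424 1933 36 1945 36, Mono 11471084860093237327 1166 48,
     Mono 5502725288328401630 1935 36, Mono 26149252783534280139 1936 33,
     Join 2772742498303159463 1937 36 1953 36, Join 1136406366656865254 1814 44 1922 44,
     Mono 457975586082182170 1939 33, Join 12318088503231639830 1948 33 1938 35,
     Join 15981536945542447619 1924 37 1954 37, Join 23386206439721413153 1180 33 1170 35,
     Mono 901597153329766330 1936 34, Mono 692095309593519829 1944 33,
     Join 13692992245874955779 1833 44 1177 52, Join 1273613243437222365 1946 36 1962 36,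
     Mono 19592600176948669000 1159 36, Mono 2966768311389215972 1198 48,
     Join 5880619551492184015 1176 34 1169 34, Join 482443297543360103 1796 40 1156 56,
     Join 265072275933453464 1944 36 1960 36, Mono 12937363013282804833 1952 34],
    [Join 8232867372089057621 1953 33 1956 33, Join 1660321708934104426 1954 35 1960 33,
     Mono 6078310857479023059 1865 36, Join 3568496833557342890 1964 33 1953 35,
     Mono 5556791966051347341 1189 48, Join 5396421752856516392 1958 50 1960 49,
     Mono 21170230385371862454 1952 33, Join 4479548467922326229 2022 34 1960 49,
     Join 5880619551492184015 1933 36 1961 36, Join 6267328016989066076 1934 36 1962 36,
     Join 12897237910620772352 1957 34 1960 33, Mono 459638239945180207 1164 48,
     Join 46878126518626890904 1847 40 1152 53, Join 9380414684174957124 1834 52 1050 52,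
     Join 8872318374566806988 1944 37 1924 38, Mono 18964402920444617978 1968 34,
     Join 8653362049795343478 1976 34 1969 34, Mono 15955698771148408881 1656 34,
     Mono 106741434866054820 1971 34, Mono 35283717308953104090 1972 34,
     Join 17242023065708586752 1827 36 1808 37, Join 1458853428064663840 1974 34 1928 37,
     Mono 5229591859545935176 1975 34, Join 8173185851859649459 1829 34 1832 33,
     Join 20211584100966661088 1839 40 1167 52, Mono 67788724767082445150 1792 36,
     Join 3067751950526992071 1953 41 1796 45, Join 5460124873785898158 1937 34 1944 34,
     Mono 13343004854282865655 1984 33, Join 15289610833879678439 1988 34 1985 35],
    [Join 9505658374652943607 1829 40 1153 52, Mono 4096809340098947911 1207 34,
     Join 5420981311547003808 1988 34 1992 33, Join 18698977330852282232 1989 34 1992 33,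
     Mono 2255693597991122248 1926 48, Mono 11123314195198306368 1984 34,
     Join 12167019519461637047 1875 36 1888 37, Join 9641274349173495264 1892 40 1984 36,
     Join 16369180521572363884 1158 44 1042 44, Mono 10224194619057862308 1069 48,
     Join 22346354295670299257 1987 36 1056 57, Mono 45062146137859901322 1416 36,
     Join 9694533433615030450 1430 34 1432 33, Join 5382670703339517657 1114 36 1130 36,
     Mono 5880619551492184015 2000 33, Mono 1314378901019784369 1025 40,
     Join 397806717598255212 2002 33 2004 33, Join 8663302530044330044 1133 48 1581 48,
     Mono 7196432433834043181 1852 48, Mono 15289610833879678439 1237 48,
     Mono 13985723930671784882 1031 34, Mono 4300176961834988010 2007 34,
     Mono 38315528535670763866 1495 36, Join 24858248623451086742 1865 41 1860 42,
     Mono 25654864259733428138 1867 40, Join 5939279124001308125 1584 49 1091 52,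
     Join 16569127106350435271 1122 56 1074 56, Join 15128856638843014188 1296 43 1411 43,
     Join 1053301457363270458 1225 49 1156 50, Join 33652956095166489029 1747 36 1568 41],
    [Mono 39399859792723739743 2016 33, Join 2584530887382874446 2020 34 1185 51,
     Join 4678209720289960974 2024 34 2018 34, Join 4316351208236127622 1700 52 1088 60,
     Join 6234766084362328967 2028 33 1185 51, Join 804871037123423329 1766 38 1544 45,
     Mono 5933101991058189630 1268 48, Mono 2822299816073336836 2023 34,
     Mono 19548983969024186023 1192 48, Join 24704752266169340526 1190 50 2024 33,
     Mono 1735144060014132064 1427 33, Mono 518234066469137414 1195 48,
     Join 8163244318182895850 1603 38 1616 38, Mono 8605876644071733037 1057 40,
     Join 9204314677455364348 1665 44 1585 44, Join 1997404829152698674 1345 38 1356 37,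
     Join 418393370513417569 1560 41 1668 42, Join 20680756380245691263 2037 34 2044 33,
     Join 1018741408784763673 1910 42 2044 33, Join 114488349374583669 1352 37 1377 38,
     Mono 4446613424453615416 1136 34, Mono 7046062249642565802 1036 40]]"
  by code_simp

section \<open>Triples in a family in which all their elements are rare\<close>

lemma card_3_obtain1:
  assumes "card T = 3" "a \<in> T"
  obtains x y where "T = {a, x, y}" "distinct [a, x, y]"
proof -
  obtain x y z where "T = {x, y, z}" "distinct [x, y, z]"
    using assms(1) by (auto simp: card_3_iff)
  moreover from this assms(2) have "a = x \<or> a = y \<or> a = z" by simp
  ultimately show ?thesis
    using that[of x y] that[of y z] that[of x z] by (auto simp: insert_commute)
qed

lemma card_3_obtain2:
  assumes "card T = 3" "a \<in> T" "b \<in> T" "a \<noteq> b"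
  obtains x where "T = {a, b, x}" "distinct [a, b, x]"
proof -
  obtain x y where xy: "T = {a, x, y}" "distinct [a, x, y]"
    using card_3_obtain1[OF assms(1,2)] .
  with assms(3,4) have "b = x \<or> b = y" by simp
  then show ?thesis using that[of x] that[of y] xy by (auto simp: insert_commute)
qed

text \<open>The situation of a counterexample: \<open>rare\<close> negates the Frankl condition at
  every element covered by \<open>A\<close>, while \<open>F\<close> is any finite union-closed
  family around the triples.\<close>

locale rare_triples = uc_family F for F :: "'a set set" +
  fixes A :: "'a set set"
  assumes A_F: "A \<subseteq> F" and card_3: "T \<in> A \<Longrightarrow> card T = 3"
    and rare: "v \<in> \<Union>A \<Longrightarrow> 2 * card {X\<in>F. v \<in> X} < card F"
begin

text \<open>The certificate yields a listed element lying in at least half of the members; the last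
  assumption places that element in a triple of \<open>A\<close>, where it must be rare.\<close>

lemma no_config:
  assumes "cert_ok ts ws ess" "distinct vs" "length vs = length ws"
    and "\<forall>t\<in>set ts. sel vs (bits t) \<in> A" "set vs \<subseteq> (\<Union>t\<in>set ts. sel vs (bits t))"
  shows False
proof -
  have "\<forall>t\<in>set ts. sel vs (bits t) \<in> F" using assms(4) A_F by blast
  from cert_sound[OF assms(1-3) this] obtain v where v: "v \<in> set vs" "card F \<le> 2 * card {X\<in>F. v \<in> X}"
    by blast
  with assms(4,5) have "v \<in> \<Union>A" by blast
  with rare v show False by fastforce
qed

section \<open>The excluded configurations\<close>

lemma no_three_on_four: "\<lbrakk>distinct [a,b,c,d]; {a,b,c} \<in> A; {a,b,d} \<in> A; {a,c,d} \<in> A\<rbrakk> \<Longrightarrow> False"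
  by (rule no_config[OF cert_three_on_four, of "[a,b,c,d]"]; simp)

lemma no_common_pair: "\<lbrakk>distinct [a,b,c,d,e]; {a,b,c} \<in> A; {a,b,d} \<in> A; {a,b,e} \<in> A\<rbrakk> \<Longrightarrow> False"
  by (rule no_config[OF cert_common_pair, of "[a,b,c,d,e]"]; simp)

lemma no_tight_path: "\<lbrakk>distinct [a,b,c,d,e]; {a,b,c} \<in> A; {b,c,d} \<in> A; {c,d,e} \<in> A\<rbrakk> \<Longrightarrow> False"
  by (rule no_config[OF cert_tight_path, of "[a,b,c,d,e]"]; simp)

lemma no_near_star: "\<lbrakk>distinct [a,b,c,d,e,f]; {a,b,c} \<in> A; {a,b,d} \<in> A; {a,e,f} \<in> A\<rbrakk> \<Longrightarrow> False"
  by (rule no_config[OF cert_near_star, of "[a,b,c,d,e,f]"]; simp)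

lemma no_star:
  "\<lbrakk>distinct [a,b,c,d,e,f,g]; {a,b,c} \<in> A; {a,d,e} \<in> A; {a,f,g} \<in> A\<rbrakk> \<Longrightarrow> False"
  by (rule no_config[OF cert_star, of "[a,b,c,d,e,f,g]"]; simp)

lemma no_closed_pair: "\<lbrakk>distinct [a,b,c,d,e]; {a,b,c} \<in> A; {a,b,d} \<in> A; {c,d,e} \<in> A\<rbrakk> \<Longrightarrow> False"
  by (rule no_config[OF cert_closed_pair, of "[a,b,c,d,e]"]; simp)

lemma no_triangle: "\<lbrakk>distinct [a,b,c,d,e,f]; {a,b,c} \<in> A; {c,d,e} \<in> A; {a,e,f} \<in> A\<rbrakk> \<Longrightarrow> False"
  by (rule no_config[OF cert_triangle, of "[a,b,c,d,e,f]"]; simp)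

lemma no_spider:
  "\<lbrakk>distinct [a,b,c,d,e,f,g,h,i]; {a,b,c} \<in> A; {a,d,e} \<in> A; {b,f,g} \<in> A; {c,h,i} \<in> A\<rbrakk> \<Longrightarrow> False"
  by (rule no_config[OF cert_spider, of "[a,b,c,d,e,f,g,h,i]"]; simp)

lemma no_fork6:
  "\<lbrakk>distinct [a,b,c,d,e,f]; {a,b,c} \<in> A; {a,b,d} \<in> A; {c,e,f} \<in> A; {d,e,f} \<in> A\<rbrakk> \<Longrightarrow> False"
  by (rule no_config[OF cert_fork6, of "[a,b,c,d,e,f]"]; simp)

lemma no_fork7:
  "\<lbrakk>distinct [a,b,c,d,e,f,g]; {a,b,c} \<in> A; {a,b,d} \<in> A; {c,e,f} \<in> A; {d,e,g} \<in> A\<rbrakk> \<Longrightarrow> False"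
  by (rule no_config[OF cert_fork7, of "[a,b,c,d,e,f,g]"]; simp)

lemma no_fork8:
  "\<lbrakk>distinct [a,b,c,d,e,f,g,h]; {a,b,c} \<in> A; {a,b,d} \<in> A; {c,e,f} \<in> A; {d,g,h} \<in> A\<rbrakk> \<Longrightarrow> False"
  by (rule no_config[OF cert_fork8, of "[a,b,c,d,e,f,g,h]"]; simp)

lemma no_dumbbell4:
  "\<lbrakk>distinct [a,b,c,d,e,f,g]; {a,b,c} \<in> A; {a,b,d} \<in> A; {c,e,f} \<in> A; {e,f,g} \<in> A\<rbrakk> \<Longrightarrow> False"
  by (rule no_config[OF cert_dumbbell4, of "[a,b,c,d,e,f,g]"]; simp)

lemma no_dumbbell5:
  "\<lbrakk>distinct [a,b,c,d,e,f,g,h,i]; {a,b,c} \<in> A; {a,b,d} \<in> A; {c,e,f} \<in> A; {e,g,h} \<in> A;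
    {g,h,i} \<in> A\<rbrakk> \<Longrightarrow> False"
  by (rule no_config[OF cert_dumbbell5, of "[a,b,c,d,e,f,g,h,i]"]; simp)

lemma no_tadpole5:
  "\<lbrakk>distinct [a,b,c,d,e,f,g,h,i,j]; {a,b,c} \<in> A; {a,b,d} \<in> A; {c,e,f} \<in> A; {e,g,h} \<in> A;
    {g,i,j} \<in> A\<rbrakk> \<Longrightarrow> False"
  by (rule no_config[OF cert_tadpole5, of "[a,b,c,d,e,f,g,h,i,j]"]; simp)

section \<open>Every element lies in at most two triples\<close>

lemma no_third_owner:
  assumes "{v,u,x} \<in> A" "{v,u,y} \<in> A" "distinct [v,u,x,y]"
    and "T \<in> A" "v \<in> T" "T \<noteq> {v,u,x}" "T \<noteq> {v,u,y}"
  shows False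
proof -
  note T3 = card_3[OF assms(4)]
  \<comment> \<open>In turn these are three triples on a common pair, a third triple through a free
    element \<open>x\<close> or \<open>y\<close> (a tight path, or three triples on four elements),
    and a third triple that meets the others in \<open>v\<close> only, a near star.\<close>
  consider "u \<in> T" | "u \<notin> T" "x \<in> T" | "u \<notin> T" "x \<notin> T" "y \<in> T" | "u \<notin> T" "x \<notin> T" "y \<notin> T"
    by blast
  then show False
  proof cases
    case 1
    then obtain z where "T = {v,u,z}" "distinct [v,u,z]"
      using card_3_obtain2[OF T3, of v u] assms by auto
    with assms show False by (intro no_common_pair[of v u x y z]) auto
  next
    case 2
    then obtain z where z: "T = {v,x,z}" "distinct [v,x,z]"
      using card_3_obtain2[OF T3, of v x] assms by auto
    show False
    proof (cases "z = y")
      case True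
      with assms z show False by (intro no_three_on_four[of v u x y]) auto
    next
      case False
      \<comment> \<open>In the order \<open>y, u, v, x, z\<close> the three triples occupy
        consecutive positions.\<close>
      with assms z 2 show False by (intro no_tight_path[of y u v x z]) (auto simp: insert_commute)
    qed
  next
    case 3
    then obtain z where z: "T = {v,y,z}" "distinct [v,y,z]"
      using card_3_obtain2[OF T3, of v y] assms by auto
    with assms 3 show False by (intro no_tight_path[of x u v y z]) (auto simp: insert_commute)
  next
    case 4
    obtain p q where "T = {v,p,q}" "distinct [v,p,q]"
      using card_3_obtain1[OF T3 assms(5)] by blast
    with assms 4 show False by (intro no_near_star[of v u x y p q]) auto
  qed
qed

lemma no_third_owner':
  assumes "T1 \<in> A" "T2 \<in> A" "T3 \<in> A" "v \<in> T1" "v \<in> T2" "v \<in> T3" "T1 \<noteq> T2" "T1 \<noteq> T3" "T2 \<noteq> T3"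
    and "u \<in> T1" "u \<in> T2" "u \<noteq> v"
  shows False
proof -
  obtain x where "T1 = {v,u,x}" "distinct [v,u,x]"
    using card_3_obtain2[OF card_3[OF assms(1)], of v u] assms by metis
  moreover obtain y where "T2 = {v,u,y}" "distinct [v,u,y]"
    using card_3_obtain2[OF card_3[OF assms(2)], of v u] assms by metis
  ultimately show False using no_third_owner[of v u x y T3] assms by auto
qed

text \<open>By \<open>no_third_owner'\<close> no two of three triples through \<open>v\<close> have
  a second common element, so they would form a star on seven elements.\<close>

lemma two_owners:
  assumes "T1 \<in> A" "T2 \<in> A" "T3 \<in> A" "v \<in> T1" "v \<in> T2" "v \<in> T3"
  shows "T1 = T2 \<or> T1 = T3 \<or> T2 = T3"
proof (rule ccontr)
  assume "\<not> ?thesis"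
  then have ne: "T1 \<noteq> T2" "T1 \<noteq> T3" "T2 \<noteq> T3" by auto
  note no = no_third_owner'[of _ _ _ v]
  have disj: "T1 \<inter> T2 \<subseteq> {v}" "T1 \<inter> T3 \<subseteq> {v}" "T2 \<inter> T3 \<subseteq> {v}"
    using no[of T1 T2 T3] no[of T1 T3 T2] no[of T2 T3 T1] assms ne by blast+
  obtain a b where T1: "T1 = {v,a,b}" "distinct [v,a,b]"
    using card_3_obtain1[OF card_3] assms by metis
  obtain c d where T2: "T2 = {v,c,d}" "distinct [v,c,d]"
    using card_3_obtain1[OF card_3] assms by metis
  obtain e f where T3: "T3 = {v,e,f}" "distinct [v,e,f]"
    using card_3_obtain1[OF card_3] assms by metis
  have "distinct [v,a,b,c,d,e,f]" using disj T1 T2 T3 by auto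
  then show False using no_star[of v a b c d e f] T1 T2 T3 assms by simp
qed

lemma not_owner:
  "\<lbrakk>T1 \<in> A; T2 \<in> A; T3 \<in> A; T1 \<noteq> T2; T3 \<noteq> T1; T3 \<noteq> T2; v \<in> T1; v \<in> T2\<rbrakk> \<Longrightarrow> v \<notin> T3"
  using two_owners by metis

section \<open>Shared elements and triples consisting of shared elements\<close>

definition shared :: "'a \<Rightarrow> bool" where
  "shared v \<longleftrightarrow> (\<exists>T\<in>A. \<exists>T'\<in>A. T \<noteq> T' \<and> v \<in> T \<and> v \<in> T')"

text \<open>The elements of degree two in \<open>T\<close>: by \<open>two_owners\<close> a shared
  element lies in exactly two triples.\<close>

definition sh :: "'a set \<Rightarrow> 'a set" where
  "sh T = {v\<in>T. shared v}"

lemma sharedI: "\<lbrakk>T \<in> A; T' \<in> A; T \<noteq> T'; v \<in> T; v \<in> T'\<rbrakk> \<Longrightarrow> shared v"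
  by (auto simp: shared_def)

lemma shared_other:
  assumes "shared v" "T \<in> A"
  obtains T' where "T' \<in> A" "T' \<noteq> T" "v \<in> T'"
  using assms unfolding shared_def by metis

text \<open>The three triples form a cycle through \<open>a\<close>, \<open>b\<close>,
  \<open>x\<close>. If \<open>p = q\<close>, the last two share the pair \<open>x, p\<close> and the
  first joins their free elements, a closed pair; otherwise they form a triangle.\<close>

lemma no_loose_triangle:
  assumes "{a,b,c} \<in> A" "{a,x,p} \<in> A" "{b,x,q} \<in> A"
    and "distinct [a,b,c,x,p]" "distinct [a,b,c,x,q]"
  shows False
proof (cases "p = q")
  case True
  with assms show False by (intro no_closed_pair[of x p a b c]) (auto simp: insert_commute)
next
  case False
  with assms show False by (intro no_triangle[of a c b q x p]) (auto simp: insert_commute)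
qed

text \<open>If the three neighbours were distinct, the degree bound would confine each to its own
  element of \<open>{a,b,c}\<close>, and \<open>no_loose_triangle\<close> would make them pairwise
  disjoint, which gives a spider.\<close>

lemma same_partner:
  assumes abc: "{a,b,c} \<in> A" "distinct [a,b,c]"
    and A: "Ta \<in> A" "Tb \<in> A" "Tc \<in> A"
    and ne: "Ta \<noteq> {a,b,c}" "Tb \<noteq> {a,b,c}" "Tc \<noteq> {a,b,c}"
    and el: "a \<in> Ta" "b \<in> Tb" "c \<in> Tc"
  shows "Ta = Tb \<or> Ta = Tc \<or> Tb = Tc"
proof (rule ccontr)
  assume "\<not> ?thesis"
  then have d: "Ta \<noteq> Tb" "Ta \<noteq> Tc" "Tb \<noteq> Tc" by auto
  have "b \<notin> Ta" by (rule not_owner[OF abc(1) A(2,1) ne(2)[symmetric] ne(1) d(1)]) (use el in simp_all)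
  moreover have "c \<notin> Ta" by (rule not_owner[OF abc(1) A(3,1) ne(3)[symmetric] ne(1) d(2)]) (use el in simp_all)
  moreover have "a \<notin> Tb"
    by (rule not_owner[OF abc(1) A(1,2) ne(1)[symmetric] ne(2) d(1)[symmetric]]) (use el in simp_all)
  moreover have "c \<notin> Tb" by (rule not_owner[OF abc(1) A(3,2) ne(3)[symmetric] ne(2) d(3)]) (use el in simp_all)
  moreover have "a \<notin> Tc"
    by (rule not_owner[OF abc(1) A(1,3) ne(1)[symmetric] ne(3) d(2)[symmetric]]) (use el in simp_all)
  moreover have "b \<notin> Tc"
    by (rule not_owner[OF abc(1) A(2,3) ne(2)[symmetric] ne(3) d(3)[symmetric]]) (use el in simp_all)
  ultimately have out: "b \<notin> Ta" "c \<notin> Ta" "a \<notin> Tb" "c \<notin> Tb" "a \<notin> Tc" "b \<notin> Tc"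
    by blast+
  obtain d e where Ta: "Ta = {a,d,e}" "distinct [a,d,e]"
    using card_3_obtain1[OF card_3] A el by metis
  obtain f g where Tb: "Tb = {b,f,g}" "distinct [b,f,g]"
    using card_3_obtain1[OF card_3] A el by metis
  obtain h i where Tc: "Tc = {c,h,i}" "distinct [c,h,i]"
    using card_3_obtain1[OF card_3] A el by metis
  \<comment> \<open>Any naming \<open>u, w, z\<close> of the triple is allowed, so that the three
    pairs of neighbours are instances of one argument.\<close>
  have tri: "T \<inter> T' = {}"
    if T: "T \<in> A" "T' \<in> A" "u \<in> T" "w \<in> T'" "T \<inter> {u,w,z} = {u}" "T' \<inter> {u,w,z} = {w}"
      and z: "{u,w,z} = {a,b,c}" "distinct [u,w,z]"
    for T T' u w z
  proof (rule ccontr)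
    assume "T \<inter> T' \<noteq> {}"
    then obtain x where x: "x \<in> T" "x \<in> T'" by blast
    then have xn: "x \<noteq> u" "x \<noteq> w" "x \<noteq> z" using T z by auto
    obtain p where p: "T = {u,x,p}" "distinct [u,x,p]"
      using card_3_obtain2[OF card_3[OF T(1)] T(3) x(1)] xn by metis
    obtain q where q: "T' = {w,x,q}" "distinct [w,x,q]"
      using card_3_obtain2[OF card_3[OF T(2)] T(4) x(2)] xn by metis
    have "p \<notin> {u,w,z}" "q \<notin> {u,w,z}" using T p q xn by auto
    then show False
      using no_loose_triangle[of u w z x p q] T p q xn z abc by auto
  qed
  have "Ta \<inter> Tb = {}" by (rule tri[of Ta Tb a b c]) (use A el out abc in auto)
  moreover have "Ta \<inter> Tc = {}" by (rule tri[of Ta Tc a c b]) (use A el out abc in auto)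
  moreover have "Tb \<inter> Tc = {}" by (rule tri[of Tb Tc b c a]) (use A el out abc in auto)
  ultimately have "distinct [a,b,c,d,e,f,g,h,i]"
    using Ta Tb Tc out abc by auto
  then show False using no_spider[of a b c d e f g h i] Ta Tb Tc A abc by simp
qed

text \<open>\<open>T2\<close> avoids \<open>a\<close> and \<open>b\<close>, which already have two
  owners, and avoids \<open>d\<close>, because of the closed pair. A further triple through
  \<open>d\<close> would form a fork with the other three.\<close>

lemma double_neighbour:
  assumes abc: "{a,b,c} \<in> A" "distinct [a,b,c]"
    and T1: "T1 \<in> A" "T1 \<noteq> {a,b,c}" "a \<in> T1" "b \<in> T1"
    and T2: "T2 \<in> A" "T2 \<noteq> {a,b,c}" "c \<in> T2"
  shows "\<exists>d. T1 = {a,b,d} \<and> distinct [a,b,c,d] \<and> \<not> shared d \<and> T2 \<inter> {a,b,d} = {}"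
proof -
  obtain d where d: "T1 = {a,b,d}" "distinct [a,b,d]"
    using card_3_obtain2[OF card_3[OF T1(1)] T1(3,4)] abc by auto
  have dc: "d \<noteq> c" using d T1 by auto
  have ne: "T2 \<noteq> T1" using d dc abc T2 by auto
  have ab2: "a \<notin> T2" "b \<notin> T2"
    using not_owner[OF abc(1) T1(1) T2(1) T1(2)[symmetric] T2(2) ne] T1 by auto
  obtain e f where ef: "T2 = {c,e,f}" "distinct [c,e,f]"
    using card_3_obtain1[OF card_3[OF T2(1)] T2(3)] by blast
  have d2: "d \<notin> T2"
  proof
    assume "d \<in> T2"
    then obtain x where "T2 = {c,d,x}" "distinct [c,d,x]"
      using card_3_obtain2[OF card_3[OF T2(1)] T2(3)] dc by metis
    then show False using no_closed_pair[of a b c d x] abc d dc ab2 T1 T2 by auto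
  qed
  have "\<not> shared d"
  proof
    assume "shared d"
    then obtain T3 where T3: "T3 \<in> A" "T3 \<noteq> T1" "d \<in> T3" using T1 shared_other by metis
    have ne3: "T3 \<noteq> {a,b,c}" "T3 \<noteq> T2" using T3 d dc d2 by auto
    have out: "a \<notin> T3" "b \<notin> T3" "c \<notin> T3"
      using not_owner[OF abc(1) T1(1) T3(1) T1(2)[symmetric] ne3(1) T3(2)]
        not_owner[OF abc(1) T2(1) T3(1) T2(2)[symmetric] ne3] T1 T2 by auto
    \<comment> \<open>The number of elements that \<open>T3\<close> has in common with
      \<open>T2\<close> decides which of the three forks appears.\<close>
    consider "e \<in> T3" "f \<in> T3" | "e \<in> T3" "f \<notin> T3" | "e \<notin> T3" "f \<in> T3" | "e \<notin> T3" "f \<notin> T3"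
      by blast
    then show False
    proof cases
      case 1
      then obtain x where "T3 = {d,e,x}" "distinct [d,e,x]"
        using card_3_obtain2[OF card_3[OF T3(1)] T3(3), of e] d2 ef by blast
      with 1 ef d2 have "T3 = {d,e,f}" by auto
      then show False
        using no_fork6[of a b c d e f] abc d dc ef ab2 d2 T1 T2 T3 by auto
    next
      case 2
      then obtain x where "T3 = {d,e,x}" "distinct [d,e,x]"
        using card_3_obtain2[OF card_3[OF T3(1)] T3(3), of e] d2 ef by blast
      then show False
        using no_fork7[of a b c d e f x] abc d dc ef ab2 d2 T1 T2 T3 out 2 by auto
    next
      case 3
      then obtain x where "T3 = {d,f,x}" "distinct [d,f,x]"
        using card_3_obtain2[OF card_3[OF T3(1)] T3(3), of f] d2 ef by blast
      then show False
        using no_fork7[of a b c d f e x] abc d dc ef ab2 d2 T1 T2 T3 out 3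
        by (auto simp: insert_commute)
    next
      case 4
      obtain x y where "T3 = {d,x,y}" "distinct [d,x,y]"
        using card_3_obtain1[OF card_3[OF T3(1)] T3(3)] by blast
      then show False
        using no_fork8[of a b c d e f x y] abc d dc ef ab2 d2 T1 T2 T3 out 4 by auto
    qed
  qed
  then show ?thesis using d dc d2 ab2 abc by auto
qed

text \<open>Two elements of \<open>T\<close> have the same second owner by
  \<open>same_partner\<close>; they are named \<open>a\<close> and \<open>b\<close>. Then
  \<open>{a,b,d}\<close> is a twin of \<open>T\<close> with a private element \<open>d\<close>, and
  the only way onward is the exit \<open>c\<close> into its second owner \<open>T2\<close>.\<close>

lemma full_triple:
  assumes "T \<in> A" "\<forall>v\<in>T. shared v"
  obtains a b c d T2 where "T = {a,b,c}" "distinct [a,b,c,d]" "{a,b,d} \<in> A" "\<not> shared d"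
    "T2 \<in> A" "T2 \<noteq> T" "c \<in> T2" "T2 \<inter> {a,b,d} = {}"
proof -
  obtain a b c where abc: "T = {a,b,c}" "distinct [a,b,c]"
    using card_3[OF assms(1)] by (auto simp: card_3_iff)
  obtain Ta where Ta: "Ta \<in> A" "Ta \<noteq> T" "a \<in> Ta" using shared_other assms abc by (metis insertI1)
  obtain Tb where Tb: "Tb \<in> A" "Tb \<noteq> T" "b \<in> Tb" using shared_other assms abc by (metis insert_iff)
  obtain Tc where Tc: "Tc \<in> A" "Tc \<noteq> T" "c \<in> Tc" using shared_other assms abc by (metis insert_iff)
  \<comment> \<open>\<open>u\<close> and \<open>w\<close> are the elements with a common second
    owner and \<open>z\<close> is the exit, so that the three cases below differ only in
    naming.\<close>
  have D: "\<exists>d. T = {u,w,z} \<and> distinct [u,w,z,d] \<and> {u,w,d} \<in> A \<and> \<not> shared d \<and> T2 \<inter> {u,w,d} = {}"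
    if "{u,w,z} = T" "distinct [u,w,z]" "T1 \<in> A" "T1 \<noteq> T" "u \<in> T1" "w \<in> T1"
      "T2 \<in> A" "T2 \<noteq> T" "z \<in> T2" for u w z T1 T2
    using double_neighbour[of u w z T1 T2] that assms(1) by blast
  from same_partner[of a b c Ta Tb Tc] abc assms(1) Ta Tb Tc
  consider "Ta = Tb" | "Ta = Tc" | "Tb = Tc" by metis
  then show thesis
  proof cases
    case 1
    then show ?thesis using D[of a b c Ta Tc] abc Ta Tb Tc that[of a b c _ Tc] by auto
  next
    case 2
    then show ?thesis using D[of a c b Ta Tb] abc Ta Tb Tc that[of a c b _ Tb] by (auto simp: insert_commute)
  next
    case 3
    then show ?thesis using D[of b c a Tb Ta] abc Ta Tb Tc that[of b c a _ Ta] by (auto simp: insert_commute)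
  qed
qed

section \<open>Chains that leave a full triple\<close>

definition adj :: "'a set \<Rightarrow> 'a set \<Rightarrow> bool" where
  "adj T T' \<longleftrightarrow> T \<noteq> T' \<and> T \<inter> T' \<noteq> {}"

text \<open>A route of one or two steps from \<open>T\<close> to \<open>E\<close>. Requiring exactly
  two shared elements in the middle triple \<open>M\<close> makes it possible to follow the route
  back from \<open>E\<close> without choice.\<close>

definition chain :: "'a set \<Rightarrow> 'a set \<Rightarrow> bool" where
  "chain T E \<longleftrightarrow> adj E T \<or> (\<exists>M\<in>A. adj E M \<and> adj M T \<and> card (sh M) = 2)"

text \<open>The chain continues through \<open>x\<close> into its second owner \<open>T3\<close>.
  One more shared element in \<open>T3\<close> would give a tadpole, and two more would make
  \<open>T3\<close> full, so that its twin completes a dumbbell. Hence \<open>T3\<close> ends the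
  chain.\<close>

lemma chain_step:
  assumes abc: "{a,b,c} \<in> A" "distinct [a,b,c,d]" "{a,b,d} \<in> A" "\<not> shared d"
    and full: "shared a" "shared b" "shared c"
    and T2: "{c,x,y} \<in> A" "distinct [c,x,y]" "{c,x,y} \<inter> {a,b,d} = {}"
    and xy: "shared x" "\<not> shared y"
  shows "\<exists>E\<in>A. card (sh E) \<le> 1 \<and> chain {a,b,c} E"
proof -
  obtain T3 where T3: "T3 \<in> A" "T3 \<noteq> {c,x,y}" "x \<in> T3" using xy T2 shared_other by metis
  have ne3: "T3 \<noteq> {a,b,c}" "T3 \<noteq> {a,b,d}" using T2 T3 by auto
  have ne: "{a,b,c} \<noteq> {a,b,d}" "{a,b,c} \<noteq> {c,x,y}" using abc(2) T2(2,3) by auto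
  \<comment> \<open>The two owners of each of \<open>a\<close>, \<open>b\<close>, \<open>c\<close>
    are already among the triples named so far.\<close>
  have out: "a \<notin> T3" "b \<notin> T3" "c \<notin> T3"
    using not_owner[OF abc(1,3) T3(1) ne(1) ne3] not_owner[OF abc(1) T2(1) T3(1) ne(2) ne3(1) T3(2)]
    by auto
  \<comment> \<open>\<open>y\<close> and \<open>d\<close> are not shared and each has an owner
    different from \<open>T3\<close>.\<close>
  have out': "y \<notin> T3" "d \<notin> T3"
    using sharedI[OF T3(1) T2(1) T3(2), of y] sharedI[OF T3(1) abc(3) ne3(2), of d] xy abc(4) by auto
  obtain p q where pq: "T3 = {x,p,q}" "distinct [x,p,q]"
    using card_3_obtain1[OF card_3[OF T3(1)] T3(3)] by blast
  have dist: "distinct [a,b,c,d,x,y,p,q]" using pq out out' abc T2 by auto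
  have none: "card (sh T3) \<le> 1 \<and> chain {a,b,c} T3" if "\<not> shared p" "\<not> shared q"
  proof -
    have "sh T3 \<subseteq> {x}" using that pq by (auto simp: sh_def)
    then have "card (sh T3) \<le> 1" using card_mono[of "{x}"] by fastforce
    moreover have "sh {c,x,y} = {c,x}" using xy full by (auto simp: sh_def)
    then have "card (sh {c,x,y}) = 2" using T2 by simp
    moreover have "adj T3 {c,x,y}" "adj {c,x,y} {a,b,c}" using T2 T3 by (auto simp: adj_def)
    ultimately show ?thesis using T2 by (auto simp: chain_def)
  qed
  \<comment> \<open>\<open>u\<close> is the shared one among \<open>p\<close> and \<open>q\<close>.
    Its second owner \<open>T4\<close> avoids every other named element, since each of these either
    has two known owners or is not shared.\<close>
  have one: False if pq': "T3 = {x,u,w}" "{u,w} = {p,q}" and sh: "shared u" "\<not> shared w" for u w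
  proof -
    have du: "distinct [a,b,c,d,x,y,u,w]" using dist pq' by (auto simp: doubleton_eq_iff)
    obtain T4 where T4: "T4 \<in> A" "T4 \<noteq> T3" "u \<in> T4" using sh T3 shared_other by metis
    have ne4: "T4 \<noteq> {a,b,c}" "T4 \<noteq> {a,b,d}" "T4 \<noteq> {c,x,y}" using T4 du by auto
    have "a \<notin> T4" "b \<notin> T4" "c \<notin> T4" "x \<notin> T4"
      using not_owner[OF abc(1,3) T4(1) ne(1) ne4(1,2)] not_owner[OF abc(1) T2(1) T4(1) ne(2) ne4(1,3)]
        not_owner[OF T2(1) T3(1) T4(1) T3(2)[symmetric] ne4(3) T4(2)] T3(3) by auto
    moreover have "y \<notin> T4" "d \<notin> T4" "w \<notin> T4"
      using sharedI[OF T4(1) T2(1) ne4(3), of y] sharedI[OF T4(1) abc(3) ne4(2), of d]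
        sharedI[OF T4(1) T3(1) T4(2), of w] sh xy abc(4) pq' by auto
    moreover obtain s t where "T4 = {u,s,t}" "distinct [u,s,t]"
      using card_3_obtain1[OF card_3[OF T4(1)] T4(3)] by blast
    ultimately show False
      using no_tadpole5[of a b c d x y u w s t] du abc T2 T3 T4 pq' by auto
  qed
  have both: False if "shared p" "shared q"
  proof -
    have "\<forall>v\<in>T3. shared v" using that xy pq by auto
    from full_triple[OF T3(1) this]
    obtain a' b' c' d' where Q: "T3 = {a',b',c'}" "distinct [a',b',c',d']" "{a',b',d'} \<in> A" "\<not> shared d'"
      by metis
    have T3T2: "T3 \<inter> {c,x,y} = {x}" using T3 out out' by auto
    have neT3: "{a',b',d'} \<noteq> T3" using Q by auto
    have neT2: "{a',b',d'} \<noteq> {c,x,y}"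
    proof
      assume "{a',b',d'} = {c,x,y}"
      then have "a' \<in> T3 \<inter> {c,x,y}" "b' \<in> T3 \<inter> {c,x,y}" using Q(1) by blast+
      then show False using T3T2 Q(2) by simp
    qed
    \<comment> \<open>Both owners of \<open>x\<close> are known, so \<open>x\<close> is not in the
      twin of \<open>T3\<close>; it must be the exit \<open>c'\<close>.\<close>
    have "x \<notin> {a',b',d'}" using not_owner[OF T2(1) T3(1) Q(3) T3(2)[symmetric] neT2 neT3] T3(3) by blast
    then have x: "x = c'" using T3 Q by auto
    have "a' \<in> T3" "b' \<in> T3" "a' \<noteq> x" "b' \<noteq> x" using Q(1,2) x by simp_all
    then have ab': "a' \<notin> {a,b,c,d,x,y}" "b' \<notin> {a,b,c,d,x,y}" using out out' by auto
    \<comment> \<open>Not being shared, \<open>d'\<close> could coincide only with \<open>d\<close>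
      or \<open>y\<close>, and these lie in other triples already.\<close>
    have "d' \<notin> {a,b,c,d,x,y}"
    proof
      assume "d' \<in> {a,b,c,d,x,y}"
      then have "d' = d \<or> d' = y" using full xy(1) Q(4) by auto
      moreover have "{a',b',d'} \<noteq> {a,b,d}" using ab' by blast
      ultimately show False
        using sharedI[OF Q(3) abc(3), of d] sharedI[OF Q(3) T2(1) neT2, of y] Q(4) by auto
    qed
    then have "distinct [a,b,c,d,x,y,a',b',d']" using dist Q(2) ab' by auto
    moreover have "{x,a',b'} \<in> A" using Q x T3 by (simp add: insert_commute)
    ultimately show False using no_dumbbell5[of a b c d x y a' b' d'] abc T2 Q by auto
  qed
  show ?thesis
  proof (cases "shared p"; cases "shared q")
    assume "shared p" "shared q"
    then show ?thesis using both by blast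
  next
    assume "shared p" "\<not> shared q"
    then show ?thesis using one[of p q] pq by blast
  next
    assume "\<not> shared p" "shared q"
    then show ?thesis using one[of q p] pq by (simp add: insert_commute)
  next
    assume "\<not> shared p" "\<not> shared q"
    then show ?thesis using none T3 by blast
  qed
qed

text \<open>Leave \<open>T\<close> through its exit \<open>c\<close> into \<open>T2\<close>. With no
  further shared element \<open>T2\<close> itself ends the chain; with one,
  \<open>chain_step\<close> continues; with two, \<open>T2\<close> is full and its twin completes
  the shorter dumbbell.\<close>

lemma full_chain:
  assumes T: "T \<in> A" "\<forall>v\<in>T. shared v"
  shows "\<exists>E\<in>A. card (sh E) \<le> 1 \<and> chain T E"
proof -
  obtain a b c d T2 where abc: "T = {a,b,c}" "distinct [a,b,c,d]" "{a,b,d} \<in> A" "\<not> shared d"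
    and T2: "T2 \<in> A" "T2 \<noteq> T" "c \<in> T2" "T2 \<inter> {a,b,d} = {}"
    using full_triple[OF T] by metis
  have full: "shared a" "shared b" "shared c" using T abc by auto
  obtain x y where xy: "T2 = {c,x,y}" "distinct [c,x,y]"
    using card_3_obtain1[OF card_3[OF T2(1)] T2(3)] by blast
  consider "\<not> shared x" "\<not> shared y" | "shared x" "\<not> shared y" | "\<not> shared x" "shared y"
    | "shared x" "shared y" by blast
  then show ?thesis
  proof cases
    case 1
    then have "sh T2 \<subseteq> {c}" using xy by (auto simp: sh_def)
    then have "card (sh T2) \<le> 1" using card_mono[of "{c}"] by fastforce
    moreover have "chain T T2" using T2 abc by (auto simp: chain_def adj_def)
    ultimately show ?thesis using T2 by blast
  next
    case 2
    then show ?thesis using chain_step[of a b c d x y] T abc full T2 xy by simp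
  next
    case 3
    have "T2 = {c,y,x}" "distinct [c,y,x]" using xy by auto
    then show ?thesis using chain_step[of a b c d y x] 3 T(1) abc full T2 by simp
  next
    case 4
    then have "\<forall>v\<in>T2. shared v" using xy full by auto
    from full_triple[OF T2(1) this]
    obtain a' b' c' d' where Q: "T2 = {a',b',c'}" "distinct [a',b',c',d']" "{a',b',d'} \<in> A" "\<not> shared d'"
      by metis
    have neT2: "{a',b',d'} \<noteq> T2" using Q by auto
    have neT: "{a',b',d'} \<noteq> T" using Q T by auto
    have "c \<notin> {a',b',d'}"
      using not_owner[OF T(1) T2(1) Q(3) T2(2)[symmetric] neT neT2, of c] T2(3) abc(1) by blast
    \<comment> \<open>The two full triples meet in \<open>c\<close>, which is the exit of
      both.\<close>
    then have c: "c = c'" using T2 Q by auto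
    have ab': "a' \<notin> {a,b,c,d}" "b' \<notin> {a,b,c,d}" using T2 Q c by auto
    have "d' \<notin> {a,b,c,d}"
    proof
      assume "d' \<in> {a,b,c,d}"
      then have "d' = d" using full Q(4) by auto
      moreover have "{a',b',d'} \<noteq> {a,b,d}" using ab' by blast
      ultimately show False using sharedI[OF Q(3) abc(3), of d] Q by auto
    qed
    then have "distinct [a,b,c,d,a',b',d']" using ab' abc Q by auto
    moreover have "{c,a',b'} \<in> A" using Q c T2 by (simp add: insert_commute)
    ultimately show ?thesis using no_dumbbell4[of a b c d a' b' d'] abc T Q by auto
  qed
qed

section \<open>Discharging along chains\<close>

lemma finite_A: "finite A"
  using A_F fin finite_subset by blast

lemma finite_sh: "T \<in> A \<Longrightarrow> finite (sh T)"
  using card_3[of T] card_ge_0_finite[of T] by (simp add: sh_def)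

lemma adj_shared:
  assumes "T \<in> A" "T' \<in> A" "adj T T'"
  obtains v where "v \<in> sh T" "v \<in> T'"
  using assms sharedI[of T T'] by (auto simp: adj_def sh_def)

text \<open>Every neighbour of \<open>E\<close> meets it in its only shared element, and that
  element has just one owner besides \<open>E\<close>.\<close>

lemma adj_unique:
  assumes "E \<in> A" "card (sh E) \<le> 1" "T \<in> A" "T' \<in> A" "adj E T" "adj E T'"
  shows "T = T'"
proof -
  obtain v where v: "v \<in> sh E" "v \<in> T" using adj_shared assms by metis
  obtain v' where v': "v' \<in> sh E" "v' \<in> T'" using adj_shared assms by metis
  have "v = v'" using v v' assms(2) finite_sh[OF assms(1)] by (metis card_le_Suc0_iff_eq One_nat_def)
  then show ?thesis using two_owners[OF assms(1,3,4)] v v' assms by (auto simp: adj_def sh_def)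
qed

text \<open>The route is traced back from \<open>E\<close>. Its single neighbour is the full triple
  or the middle triple, told apart by three against two shared elements. From the middle triple, the
  shared element not lying in \<open>E\<close> leads to one triple only.\<close>

lemma chain_inj:
  assumes E: "E \<in> A" "card (sh E) \<le> 1"
    and T: "T \<in> A" "card (sh T) = 3" "chain T E" and T': "T' \<in> A" "card (sh T') = 3" "chain T' E"
  shows "T = T'"
proof -
  consider "adj E T" "adj E T'" | M where "adj E T" "M \<in> A" "adj E M" "card (sh M) = 2"
    | M where "adj E T'" "M \<in> A" "adj E M" "card (sh M) = 2"
    | M M' where "M \<in> A" "adj E M" "adj M T" "card (sh M) = 2" "M' \<in> A" "adj E M'" "adj M' T'"
    using T(3) T'(3) unfolding chain_def by metis
  then show ?thesis
  proof cases
    case 1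
    then show ?thesis using adj_unique E T T' by blast
  next
    \<comment> \<open>The single neighbour of \<open>E\<close> would have three shared elements as
      \<open>T\<close> and two as \<open>M\<close>.\<close>
    case 2
    then show ?thesis using adj_unique[OF E T(1), of M] T by auto
  next
    case 3
    then show ?thesis using adj_unique[OF E T'(1), of M] T' by auto
  next
    case 4
    then have M: "adj M T'" using adj_unique[OF E, of M M'] by auto
    obtain e where e: "e \<in> sh M" "e \<in> E"
      using adj_shared[of M E] 4 E by (auto simp: adj_def)
    obtain u where u: "u \<in> sh M" "u \<in> T" using adj_shared[of M T] 4 T by metis
    obtain u' where u': "u' \<in> sh M" "u' \<in> T'" using adj_shared[of M T'] 4 T' M by metis
    have ne: "E \<noteq> T" "E \<noteq> T'" "E \<noteq> M" "M \<noteq> T" "M \<noteq> T'" using 4 E T T' M by (auto simp: adj_def)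
    \<comment> \<open>The owners of \<open>e\<close> are \<open>E\<close> and \<open>M\<close>, so
      neither \<open>T\<close> nor \<open>T'\<close> contains it; both must meet \<open>M\<close> in
      its other shared element.\<close>
    have "u \<noteq> e" "u' \<noteq> e"
      using two_owners[OF E(1) \<open>M \<in> A\<close> T(1), of u] two_owners[OF E(1) \<open>M \<in> A\<close> T'(1), of u'] e u u' ne
      by (auto simp: sh_def)
    obtain s t where "sh M = {s,t}" using 4 by (auto simp: card_2_iff)
    then have "u = u'" using e u u' \<open>u \<noteq> e\<close> \<open>u' \<noteq> e\<close> by auto
    then show ?thesis using two_owners[OF \<open>M \<in> A\<close> T(1) T'(1), of u] u u' ne by (auto simp: sh_def)
  qed
qed

text \<open>Relative to an average of two, a triple in \<open>D\<close> has one shared element too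
  many and a triple in \<open>L\<close> at least one too few. Chains assign to different triples in
  \<open>D\<close> different triples in \<open>L\<close>, which pay for the excess.\<close>

lemma sum_sh_le: "(\<Sum>T\<in>A. card (sh T)) \<le> 2 * card A"
proof -
  define D where "D = {T\<in>A. card (sh T) = 3}"
  define L where "L = {T\<in>A. card (sh T) \<le> 1}"
  have sh3: "card (sh T) \<le> 3" if "T \<in> A" for T
    using card_mono[of T "sh T"] card_3[OF that] by (auto simp: sh_def card_ge_0_finite)
  have fullD: "\<forall>v\<in>T. shared v" if "T \<in> D" for T
  proof -
    have "T \<in> A" "card (sh T) = 3" using that by (auto simp: D_def)
    then have "sh T = T" using card_3[of T] card_seteq[of T "sh T"]
      by (auto simp: sh_def card_ge_0_finite)
    then show ?thesis by (auto simp: sh_def)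
  qed
  define f where "f T = (SOME E. E \<in> L \<and> chain T E)" for T
  have f: "f T \<in> L \<and> chain T (f T)" if "T \<in> D" for T
  proof -
    have "T \<in> A" using that by (simp add: D_def)
    from full_chain[OF this fullD[OF that]] have "\<exists>E. E \<in> L \<and> chain T E"
      by (auto simp: L_def)
    then show ?thesis unfolding f_def by (rule someI_ex)
  qed
  have "inj_on f D"
  proof (rule inj_onI)
    fix T T' assume *: "T \<in> D" "T' \<in> D" "f T = f T'"
    then show "T = T'" using f[of T] f[of T'] chain_inj[of "f T" T T'] by (auto simp: D_def L_def)
  qed
  then have "card D \<le> card L"
    using f finite_A by (intro card_inj_on_le[of f]) (auto simp: L_def)
  \<comment> \<open>Termwise, a triple in \<open>D\<close> has 3 on both sides, one in
    \<open>L\<close> has at most 2 on the left, and any other has exactly two shared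
    elements.\<close>
  moreover have "(\<Sum>T\<in>A. card (sh T) + of_bool (T \<in> L)) \<le> (\<Sum>T\<in>A. 2 + of_bool (T \<in> D))"
    by (rule sum_mono) (use sh3 in \<open>force simp: D_def L_def\<close>)
  moreover have "(\<Sum>T\<in>A. of_bool (T \<in> L)) = card L" "(\<Sum>T\<in>A. of_bool (T \<in> D)) = card D"
    using finite_A by (auto simp: L_def D_def intro!: arg_cong[where f=card])
  ultimately show ?thesis
    unfolding sum.distrib by simp
qed

section \<open>Counting weighted incidences of elements and triples\<close>

lemma card_owners: "(if shared v then 1 else 2) * card {T\<in>A. v \<in> T} \<le> 2"
proof (cases "shared v")
  case True
  then obtain T T' where T: "T \<in> A" "T' \<in> A" "T \<noteq> T'" "v \<in> T" "v \<in> T'" by (auto simp: shared_def)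
  then have "{T\<in>A. v \<in> T} \<subseteq> {T, T'}" using two_owners[of T T' _ v] by auto
  then have "card {T\<in>A. v \<in> T} \<le> card {T, T'}" by (intro card_mono) auto
  then show ?thesis using True T by simp
next
  case False
  then have "card {T\<in>A. v \<in> T} \<le> Suc 0"
    using finite_A by (subst card_le_Suc0_iff_eq) (auto simp: shared_def)
  then show ?thesis using False by simp
qed

text \<open>Elements weigh 1 if shared and 2 otherwise. A triple weighs 6 minus the number of its
  shared elements, so all incidences together weigh at least \<open>4 * card A\<close> by
  \<open>sum_sh_le\<close>. By \<open>card_owners\<close> each element contributes at most 2, which
  bounds the same total by \<open>2 * card (\<Union>A)\<close>.\<close>

theorem card_triples_le: "2 * card A \<le> card (\<Union>A)"
proof -
  let ?w = "\<lambda>v. if shared v then 1 else 2 :: nat"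
  have fT: "finite T" if "T \<in> A" for T using card_3[OF that] by (simp add: card_ge_0_finite)
  have fU: "finite (\<Union>A)" using finite_A fT by blast
  have "(\<Sum>v\<in>T. ?w v) + card (sh T) = 6" if "T \<in> A" for T
  proof -
    have "(\<Sum>v\<in>T. ?w v) + card (sh T) = (\<Sum>v\<in>T. ?w v) + (\<Sum>v\<in>T. of_bool (shared v))"
      using fT[OF that] by (simp add: sh_def sum_of_bool_eq Int_def)
    also have "\<dots> = (\<Sum>v\<in>T. 2)" unfolding sum.distrib[symmetric] by (rule sum.cong) auto
    finally show ?thesis using card_3[OF that] by simp
  qed
  then have "(\<Sum>T\<in>A. (\<Sum>v\<in>T. ?w v) + card (sh T)) = 6 * card A" by simp
  then have "4 * card A \<le> (\<Sum>T\<in>A. \<Sum>v\<in>T. ?w v)"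
    using sum_sh_le by (simp add: sum.distrib)
  also have "\<dots> = (\<Sum>T\<in>A. \<Sum>v\<in>{v\<in>\<Union>A. v \<in> T}. ?w v)"
    by (intro sum.cong) auto
  also have "\<dots> = (\<Sum>v\<in>\<Union>A. \<Sum>T\<in>{T\<in>A. v \<in> T}. ?w v)"
    using finite_A fU by (rule sum.swap_restrict)
  also have "\<dots> \<le> (\<Sum>v\<in>\<Union>A. 2)"
    using card_owners by (intro sum_mono) (simp add: mult.commute split: if_splits)
  finally show ?thesis by simp
qed

end

section \<open>From Non-FC families to the bound on \<open>k\<close>\<close>

theorem theorem12:
  fixes n :: nat
  assumes "n \<ge> 4"
  shows "\<forall>k. NFC3_prop n k \<longrightarrow> 2 * k \<le> n"
proof (intro allI impI)
  fix k
  assume "NFC3_prop n k"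
  \<comment> \<open>Every \<open>k\<close> that satisfies \<open>NFC3_prop n k\<close> is bounded,
    and with it the largest one.\<close>
  then obtain A where A: "three_cover n k A" "non_frankl_complete (generated A)"
    by (auto simp: NFC3_prop_def)
  \<comment> \<open>Failure of completeness provides a union-closed family in which each element of
    the union of \<open>generated A\<close> lies in fewer than half of the members.\<close>
  then obtain F where F: "finite F" "union_closed F" "generated A \<subseteq> F"
    "\<not> (\<exists>i\<in>\<Union>(generated A). 2 * card {X\<in>F. i \<in> X} \<ge> card F)"
    by (auto simp: non_frankl_complete_def frankl_complete_def)
  have sub: "A \<subseteq> generated A" by (auto simp: generated_def)
  \<comment> \<open>Containment in \<open>F\<close> and rareness pass from
    \<open>generated A\<close> to the generating triples, which form a subfamily of it.\<close>
  interpret rare_triples F A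
  proof
    show "2 * card {X\<in>F. v \<in> X} < card F" if "v \<in> \<Union>A" for v
      using F(4) sub that by (meson Union_mono not_le subsetD)
  qed (use A F sub in \<open>auto simp: union_closed_def three_cover_def\<close>)
  show "2 * k \<le> n"
    using card_triples_le A(1) by (simp add: three_cover_def)
qed

end
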